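(* Let $H(y)=\frac12 y^{\intercal}My+V(y)$ and consider the system $y'(t)=Q\nabla H(y(t))$, $y(0)=y_0\in\mathbb{R}^d$, where $Q$ is an invertible real $d\times d$ matrix, $M$ is a symmetric real $d\times d$ matrix and $V:\mathbb{R}^d\to\mathbb{R}$ is differentiable. Let $\tilde u$ be the solution, and $y_1=\tilde u(1)$ the result, of one step of size $h$ of the ECr method from $y_0$. Suppose $Q$ is skew symmetric, so that $H$ is a first integral of the system. (i) If $\tilde u\in X_h$, then the method preserves $H$ exactly: $H(y_1)=H(y_0)$. (ii) If $\tilde u\notin X_h$, then the method preserves $H$ approximately, with accuracy $H(y_1)=H(y_0)+\mathcal{O}(h^{2r+1})$ as $h\to0$.
   Context: Put $A=QM$ and $g(y)=Q\nabla V(y)$, so the system reads $y'=Ay+g(y)$. Function spaces. Fix an integer $r\ge1$ and fixed ($h$-independent) sufficiently smooth real functions $\varphi_0,\dots,\varphi_{r-1}$ of time. For a stepsize $h>0$ and any function $\varphi$ write $\tilde\varphi(\tau)=\varphi(\tau h)$, $\tau\in[0,1]$. The functions $\tilde\varphi_0,\dots,\tilde\varphi_{r-1}$ are assumed linearly independent on $[0,1]$. Define $$Y_h=\Big\{\tilde w:\ \tilde w(\tau)=\sum_{i=0}^{r-1}\tilde\varphi_i(\tau)W_i,\ \tau\in[0,1],\ W_i\in\mathbb{R}^d\Big\}.$$ $X_h$ is a finite-dimensional space of $\mathbb{R}^d$-valued functions on $[0,1]$ such that $\tilde w'\in Y_h$ for every $\tilde w\in X_h$. A prime on a tilde function is the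 time derivative: if $\tilde w(\tau)=w(\tau h)$, then $\tilde w'(\tau)=w'(\tau h)$, i.e. $\frac{d}{d\tau}\tilde w=h\tilde w'$. Let $\langle w_1,w_2\rangle=\int_0^1 w_1(\tau)\cdot w_2(\tau)\,d\tau$, let $\tilde\psi_0,\dots,\tilde\psi_{r-1}$ be an orthonormal basis of $\mathrm{span}\{\tilde\varphi_0,\dots,\tilde\varphi_{r-1}\}$ for this inner product, and $P_{\tau,\sigma}=\sum_{i=0}^{r-1}\tilde\psi_i(\tau)\tilde\psi_i(\sigma)$. The orthogonal projection onto $Y_h$ is $\mathcal{P}_h\tilde w(\tau)=\int_0^1P_{\tau,\sigma}\tilde w(\sigma)\,d\sigma$. ECr method. One step of size $h$ from $y_0$ is $$\tilde u(\tau)=e^{\tau hA}y_0+\tau h\int_0^1\bar A_{\tau,\sigma}(A)\,g(\tilde u(\sigma))\,d\sigma,\qquad y_1=\tilde u(1),$$ $$\bar A_{\tau,\sigma}(A)=\int_0^1e^{(1-\xi)\tau hA}P_{\xi\tau,\sigma}\,d\xi .$$ Equivalently $\tilde u(0)=y_0$ and $\tilde u'(\tau)=A\tilde u(\tau)+\mathcal{P}_hg(\tilde u(\tau))$. Conventions for the $\mathcal{O}$-statement. $V$ is sufficiently smooth (e.g. $C^\infty$). For sufficiently small $h$, $\tilde u$ is the unique solution with values in a ball of fixed radius about $e^{\tau hA}y_0$; it depends smoothly on $h$. An $h$-dependent function $w(\tau)$ is called regular if $w(\tau)=\sum_{n=0}^{r-1}w^{[n]}(\tau)h^n+\mathcal{O}(h^r)$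 with each $w^{[n]}(\tau)=\frac1{n!}\frac{\partial^n w(\tau)}{\partial h^n}\big|_{h=0}$ having polynomial entries in $\tau$ of degree $\le n$. The spaces $Y_h$ have the following properties, recalled from the literature: $P_{\tau,\sigma}$ extends smoothly in $h$ to $h=0$ by its limit, and $\mathcal{P}_hw-w=\mathcal{O}(h^r)$ for every regular $w$. *)

theory Defs
  imports
    "HOL-Analysis.Analysis"
    "HOL-Library.Landau_Symbols"
    "HOL-Computational_Algebra.Polynomial"
begin

section \<open>The system\<close>

definition grad :: "('a::real_inner \<Rightarrow> real) \<Rightarrow> 'a \<Rightarrow> 'a" where
  "grad f x = (THE D. GDERIV f x :> D)"

definition energy :: "real^'d^'d \<Rightarrow> (real^'d \<Rightarrow> real) \<Rightarrow> real^'d \<Rightarrow> real" where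
  "energy M V y = 1/2 * (y \<bullet> (M *v y)) + V y"

definition first_integral :: "('a::real_normed_vector \<Rightarrow> 'a) \<Rightarrow> ('a \<Rightarrow> real) \<Rightarrow> bool" where
  "first_integral f H \<longleftrightarrow>
     (\<forall>(T::real set) y. is_interval T \<and>
        (\<forall>t\<in>T. (y has_vector_derivative f (y t)) (at t within T)) \<longrightarrow>
        (\<forall>s\<in>T. \<forall>t\<in>T. H (y s) = H (y t)))"

text \<open>For a Euclidean domain and a set \<open>S\<close> on which derivatives within \<open>S\<close> are unique (the whole
  space, a nondegenerate interval) this is k-fold continuous differentiability.\<close>

primrec Ck_on :: "nat \<Rightarrow> 'a set \<Rightarrow> ('a::euclidean_space \<Rightarrow> 'b::real_normed_vector) \<Rightarrow> bool" where
  "Ck_on 0 S f \<longleftrightarrow> continuous_on S f"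
| "Ck_on (Suc k) S f \<longleftrightarrow>
     (\<exists>f'. (\<forall>x\<in>S. (f has_derivative f' x) (at x within S)) \<and> (\<forall>v. Ck_on k S (\<lambda>x. f' x v)))"

text \<open>The exponential series is written out because multiplication in the type class instance for
  \<open>vec\<close>, and hence its power operation, is componentwise.\<close>

definition matrix_exp :: "real^'d^'d \<Rightarrow> real^'d^'d" where
  "matrix_exp A = (\<Sum>n. (((**) A) ^^ n) (mat 1) /\<^sub>R fact n)"

section \<open>Function spaces\<close>

text \<open>A function on \<open>[0,1]\<close> is represented by a total function whose values outside \<open>[0,1]\<close> are
  irrelevant; accordingly every function space below is closed under changing such values.\<close>

definition stretch :: "real \<Rightarrow> (real \<Rightarrow> 'a) \<Rightarrow> real \<Rightarrow> 'a" where
  "stretch h \<phi> \<tau> = \<phi> (\<tau> * h)"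

definition scalar_span :: "nat \<Rightarrow> (nat \<Rightarrow> real \<Rightarrow> real) \<Rightarrow> (real \<Rightarrow> real) set" where
  "scalar_span r f = {w. \<exists>c. \<forall>\<tau>\<in>{0..1}. w \<tau> = (\<Sum>i<r. c i * f i \<tau>)}"

definition lin_indep_01 :: "nat \<Rightarrow> (nat \<Rightarrow> real \<Rightarrow> real) \<Rightarrow> bool" where
  "lin_indep_01 r f \<longleftrightarrow>
     (\<forall>c. (\<forall>\<tau>\<in>{0..1}. (\<Sum>i<r. c i * f i \<tau>) = 0) \<longrightarrow> (\<forall>i<r. c i = 0))"

definition Y_space :: "nat \<Rightarrow> (nat \<Rightarrow> real \<Rightarrow> real) \<Rightarrow> real \<Rightarrow> (real \<Rightarrow> real^'d) set" where
  "Y_space r \<phi> h =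
     {w. \<exists>W. \<forall>\<tau>\<in>{0..1}. w \<tau> = (\<Sum>i<r. stretch h (\<phi> i) \<tau> *\<^sub>R W i)}"

definition finite_dim_space_01 :: "(real \<Rightarrow> 'a::real_vector) set \<Rightarrow> bool" where
  "finite_dim_space_01 X \<longleftrightarrow>
     (\<exists>B. finite B \<and> X = {w. \<exists>c. \<forall>\<tau>\<in>{0..1}. w \<tau> = (\<Sum>b\<in>B. c b *\<^sub>R b \<tau>)})"

text \<open>The factor \<open>h\<close> is there because a prime on a function of \<open>\<tau>\<close> denotes the derivative with
  respect to the time \<open>t = \<tau> h\<close>, so that \<open>d w / d \<tau> = h w'\<close>.\<close>

definition X_admissible ::
  "nat \<Rightarrow> (nat \<Rightarrow> real \<Rightarrow> real) \<Rightarrow> real \<Rightarrow> (real \<Rightarrow> real^'d) set \<Rightarrow> bool" where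
  "X_admissible r \<phi> h X \<longleftrightarrow> finite_dim_space_01 X \<and>
     (\<forall>w\<in>X. \<exists>w'\<in>Y_space r \<phi> h. \<forall>\<tau>\<in>{0..1}.
        (w has_vector_derivative h *\<^sub>R w' \<tau>) (at \<tau> within {0..1}))"

definition orthonormal_basis_01 ::
  "nat \<Rightarrow> (nat \<Rightarrow> real \<Rightarrow> real) \<Rightarrow> (nat \<Rightarrow> real \<Rightarrow> real) \<Rightarrow> bool" where
  "orthonormal_basis_01 r f \<psi> \<longleftrightarrow>
     scalar_span r \<psi> = scalar_span r f \<and>
     (\<forall>i<r. \<forall>j<r. integral {0..1} (\<lambda>\<tau>. \<psi> i \<tau> * \<psi> j \<tau>) = (if i = j then 1 else 0))"

definition kernel :: "nat \<Rightarrow> (nat \<Rightarrow> real \<Rightarrow> real) \<Rightarrow> real \<Rightarrow> real \<Rightarrow> real" where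
  "kernel r \<psi> \<tau> \<sigma> = (\<Sum>i<r. \<psi> i \<tau> * \<psi> i \<sigma>)"

definition proj ::
  "nat \<Rightarrow> (nat \<Rightarrow> real \<Rightarrow> real) \<Rightarrow> (real \<Rightarrow> real^'d) \<Rightarrow> real \<Rightarrow> real^'d" where
  "proj r \<psi> w \<tau> = integral {0..1} (\<lambda>\<sigma>. kernel r \<psi> \<tau> \<sigma> *\<^sub>R w \<sigma>)"

section \<open>The method\<close>

definition Abar ::
  "real \<Rightarrow> (real \<Rightarrow> real \<Rightarrow> real) \<Rightarrow> real^'d^'d \<Rightarrow> real \<Rightarrow> real \<Rightarrow> real^'d^'d" where
  "Abar h P A \<tau> \<sigma> =
     integral {0..1} (\<lambda>\<xi>. P (\<xi> * \<tau>) \<sigma> *\<^sub>R matrix_exp (((1 - \<xi>) * \<tau> * h) *\<^sub>R A))"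

text \<open>Absolute integrability says that the integral over \<open>\<sigma>\<close> exists as a Lebesgue integral;
  without it the equation could hold for the arbitrary value that \<^const>\<open>integral\<close> takes on a
  non-integrable function. It is automatic when \<open>g\<close> and \<open>u\<close> are continuous.\<close>

definition ECr_solution ::
  "real \<Rightarrow> (real \<Rightarrow> real \<Rightarrow> real) \<Rightarrow> real^'d^'d \<Rightarrow> (real^'d \<Rightarrow> real^'d) \<Rightarrow> real^'d
     \<Rightarrow> (real \<Rightarrow> real^'d) \<Rightarrow> bool" where
  "ECr_solution h P A g y0 u \<longleftrightarrow>
     (\<lambda>\<sigma>. g (u \<sigma>)) absolutely_integrable_on {0..1} \<and>
     (\<forall>\<tau>\<in>{0..1}. u \<tau> = matrix_exp ((\<tau> * h) *\<^sub>R A) *v y0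
        + (\<tau> * h) *\<^sub>R integral {0..1} (\<lambda>\<sigma>. Abar h P A \<tau> \<sigma> *v g (u \<sigma>)))"

section \<open>Expansions in the stepsize\<close>

text \<open>An \<open>h\<close>-dependent function of \<open>\<tau>\<close> is written \<open>w h \<tau>\<close>. Order symbols for such functions are
  uniform in \<open>\<tau> \<in> [0,1]\<close>.\<close>

definition unif_bigo_power :: "nat \<Rightarrow> (real \<Rightarrow> real \<Rightarrow> 'a::real_normed_vector) \<Rightarrow> bool" where
  "unif_bigo_power k f \<longleftrightarrow>
     (\<exists>C. \<forall>\<^sub>F h in at_right 0. \<forall>\<tau>\<in>{0..1}. norm (f h \<tau>) \<le> C * h ^ k)"

text \<open>\<open>D n h \<tau>\<close> is the n-th derivative of \<open>w\<close> with respect to \<open>h\<close>, one-sided at \<open>h = 0\<close>, so the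
  coefficient of \<open>h ^ n\<close> is \<open>D n 0 \<tau> / n!\<close>. Continuity in \<open>\<tau>\<close> ensures that the projection of
  \<open>w h\<close> is given by convergent integrals.\<close>

definition regular :: "nat \<Rightarrow> (real \<Rightarrow> real \<Rightarrow> real^'d) \<Rightarrow> bool" where
  "regular r w \<longleftrightarrow>
     (\<exists>h0>0. \<exists>D :: nat \<Rightarrow> real \<Rightarrow> real \<Rightarrow> real^'d.
        (\<forall>h\<in>{0..h0}. continuous_on {0..1} (w h)) \<and>
        (\<forall>h\<in>{0..h0}. \<forall>\<tau>\<in>{0..1}. D 0 h \<tau> = w h \<tau>) \<and>
        (\<forall>n. Suc n < r \<longrightarrow> (\<forall>h\<in>{0..h0}. \<forall>\<tau>\<in>{0..1}.
           ((\<lambda>s. D n s \<tau>) has_vector_derivative D (Suc n) h \<tau>) (at h within {0..h0}))) \<and>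
        (\<forall>n<r. \<forall>j. \<exists>p::real poly. degree p \<le> n \<and>
           (\<forall>\<tau>\<in>{0..1}. (D n 0 \<tau> /\<^sub>R fact n) $ j = poly p \<tau>)) \<and>
        unif_bigo_power r (\<lambda>h \<tau>. w h \<tau> - (\<Sum>n<r. h ^ n *\<^sub>R (D n 0 \<tau> /\<^sub>R fact n))))"

definition kernel_extends_smoothly ::
  "nat \<Rightarrow> (real \<Rightarrow> nat \<Rightarrow> real \<Rightarrow> real) \<Rightarrow> real \<Rightarrow> bool" where
  "kernel_extends_smoothly r \<psi> h0 \<longleftrightarrow>
     (\<exists>P :: real \<Rightarrow> real \<Rightarrow> real \<Rightarrow> real. \<forall>\<tau>\<in>{0..1}. \<forall>\<sigma>\<in>{0..1}.
        (\<forall>h\<in>{0<..h0}. P h \<tau> \<sigma> = kernel r (\<psi> h) \<tau> \<sigma>) \<and> Ck_on r {0..h0} (\<lambda>h. P h \<tau> \<sigma>))"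

end

theory Submission
  imports Defs
begin

text \<open>
  Let \<open>G = g \<circ> u\<close> and let \<open>e = G - P G\<close> be its projection error. Differentiating the
  variation-of-constants formula gives \<open>du/d\<tau> = h (A u + P G)\<close>, and skewness of \<open>Q\<close> turns the
  change of the energy over one step into \<open>h \<integral> (Q\<^sup>-\<^sup>1 e) \<bullet> (A u + P G)\<close>. If \<open>u\<close> lies in \<open>X\<close>, the second
  factor lies in \<open>Y\<close>, to which \<open>e\<close> is orthogonal. In general that orthogonality allows \<open>A u + P G\<close> to be
  replaced by \<open>A u - P (A u)\<close>, and each of the two factors has mean square \<open>O(h^(2r))\<close>.

  For the latter bound \<open>u\<close> is expanded, with remainder \<open>O(h^k)\<close>, into a polynomial in \<open>h\<close> whose n-th
  coefficient is a polynomial of degree at most n in \<open>\<tau>\<close>, by induction on \<open>k \<le> r\<close>: an expansion of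
  \<open>u\<close> yields one of \<open>G\<close> of the same order, and integrating the differential equation gains one power
  of \<open>h\<close>. Such polynomials are regular, so the hypothesis on projections applies to them, and the
  remainders are controlled because projections are contractions in the mean square. In this way
  the differentiability of \<open>u\<close> in \<open>h\<close> never has to be established.
\<close>

section \<open>The matrix exponential\<close>

text \<open>On finite-dimensional spaces bilinearity already gives boundedness; in this form the
  matrix products obey the product rule and commute with finite sums and integrals.\<close>

lemma bounded_bilinear_matrix_mult:
  "bounded_bilinear ((**) :: real^'n^'m \<Rightarrow> real^'k^'n \<Rightarrow> real^'k^'m)"
  by (auto intro!: bilinear_conv_bounded_bilinear[THEN iffD1] linearI simp: bilinear_def
      vec_eq_iff matrix_matrix_mult_def sum.distrib sum_distrib_left algebra_simps)

lemma bounded_bilinear_matrix_vector_mult: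
  "bounded_bilinear ((*v) :: real^'n^'m \<Rightarrow> real^'n \<Rightarrow> real^'m)"
  by (auto intro!: bilinear_conv_bounded_bilinear[THEN iffD1] linearI simp: bilinear_def
      vec_eq_iff matrix_vector_mult_def sum.distrib sum_distrib_left algebra_simps)

abbreviation mpow :: "real^'n^'n \<Rightarrow> nat \<Rightarrow> real^'n^'n" where
  "mpow A n \<equiv> ((**) A ^^ n) (mat 1)"

lemma mpow_scaleR: "mpow (t *\<^sub>R A) n = t ^ n *\<^sub>R mpow A n" for A :: "real^'n^'n"
  by (induction n) (simp_all add: scalar_matrix_assoc matrix_scalar_ac mult.commute flip: scalar_mult_eq_scaleR)

lemma mpow_commute: "A ** mpow A n = mpow A n ** A" for A :: "real^'n^'n"
  by (induction n) (simp, metis funpow.simps(2) matrix_mul_assoc o_apply)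

text \<open>The sum of all absolute entries dominates every absolute row sum, so each further factor
  \<open>A\<close> costs at most one factor of this constant. The row index stays free in the
  induction because a left multiplication mixes all rows of the power.\<close>

lemma mpow_entry_bound:
  fixes A :: "real^'n^'n"
  shows "\<bar>mpow A n $ i $ j\<bar> \<le> (\<Sum>i\<in>UNIV. \<Sum>k\<in>UNIV. \<bar>A $ i $ k\<bar>) ^ n"
proof (induction n arbitrary: i)
  case 0
  show ?case by (simp add: mat_def)
next
  case (Suc n)
  let ?K = "\<Sum>i\<in>UNIV. \<Sum>k\<in>UNIV. \<bar>A $ i $ k\<bar>"
  have "\<bar>mpow A (Suc n) $ i $ j\<bar> = \<bar>\<Sum>k\<in>UNIV. A $ i $ k * mpow A n $ k $ j\<bar>"
    by (simp add: matrix_matrix_mult_def)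
  also have "\<dots> \<le> (\<Sum>k\<in>UNIV. \<bar>A $ i $ k\<bar> * ?K ^ n)"
    by (rule order_trans[OF sum_abs]) (auto simp: abs_mult intro!: sum_mono mult_left_mono Suc.IH)
  also have "\<dots> = (\<Sum>k\<in>UNIV. \<bar>A $ i $ k\<bar>) * ?K ^ n"
    by (simp add: sum_distrib_right)
  also have "(\<Sum>k\<in>UNIV. \<bar>A $ i $ k\<bar>) \<le> ?K"
    by (rule member_le_sum) (auto intro: sum_nonneg)
  then have "(\<Sum>k\<in>UNIV. \<bar>A $ i $ k\<bar>) * ?K ^ n \<le> ?K * ?K ^ n"
    by (intro mult_right_mono zero_le_power sum_nonneg) auto
  finally show ?case by simp
qed

lemma norm_matrix_le_entries:
  fixes A :: "real^'n^'m"
  shows "norm A \<le> (\<Sum>i\<in>UNIV. \<Sum>j\<in>UNIV. \<bar>A $ i $ j\<bar>)"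
  unfolding norm_vec_def[of A]
  by (rule order_trans[OF L2_set_le_sum sum_mono]) (auto intro: norm_le_l1_cart)

text \<open>Comparison with a scalar exponential series; the factor
  \<open>CARD('n) * CARD('n)\<close> pays for the passage from entries to the norm.\<close>

lemma summable_matrix_exp: "summable (\<lambda>n. mpow A n /\<^sub>R fact n)" for A :: "real^'n^'n"
proof (rule summable_comparison_test'[where N = 0])
  let ?K = "\<Sum>i\<in>UNIV. \<Sum>k\<in>UNIV. \<bar>A $ i $ k\<bar>"
  show "summable (\<lambda>n. (CARD('n) * CARD('n)) * (?K ^ n /\<^sub>R fact n))"
    by (intro summable_mult summable_exp_generic)
  show "norm (mpow A n /\<^sub>R fact n) \<le> (CARD('n) * CARD('n)) * (?K ^ n /\<^sub>R fact n)" for n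
  proof -
    have "norm (mpow A n) \<le> (\<Sum>i\<in>UNIV. \<Sum>j\<in>UNIV. \<bar>mpow A n $ i $ j\<bar>)"
      by (rule norm_matrix_le_entries)
    also have "\<dots> \<le> (\<Sum>(i::'n)\<in>UNIV. \<Sum>(j::'n)\<in>UNIV. ?K ^ n)"
      by (intro sum_mono mpow_entry_bound)
    finally show ?thesis by (simp add: field_simps)
  qed
qed

text \<open>Each entry of the exponential is an everywhere convergent scalar power series in
  \<open>t\<close>, which opens the way to termwise differentiation.\<close>

lemma matrix_exp_entry_sums:
  fixes A :: "real^'n^'n"
  shows "(\<lambda>n. (mpow A n $ i $ j / fact n) * t ^ n) sums (matrix_exp (t *\<^sub>R A) $ i $ j)"
proof -
  have "bounded_linear (\<lambda>B :: real^'n^'n. B $ i $ j)"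
    by (rule bounded_linear_compose[OF bounded_linear_vec_nth bounded_linear_vec_nth])
  from bounded_linear.sums[OF this summable_sums[OF summable_matrix_exp[of "t *\<^sub>R A"]]]
  show ?thesis
    by (simp add: matrix_exp_def mpow_scaleR field_simps)
qed

lemma matrix_exp_commute: "A ** matrix_exp (t *\<^sub>R A) = matrix_exp (t *\<^sub>R A) ** A"
  for A :: "real^'n^'n"
proof -
  have bl: "bounded_linear (\<lambda>B. A ** B)" "bounded_linear (\<lambda>B. B ** A)"
    by (rule bounded_bilinear.bounded_linear_right[OF bounded_bilinear_matrix_mult],
        rule bounded_bilinear.bounded_linear_left[OF bounded_bilinear_matrix_mult])
  let ?f = "\<lambda>n. mpow (t *\<^sub>R A) n /\<^sub>R fact n"
  have "(\<lambda>n. A ** ?f n) = (\<lambda>n. ?f n ** A)"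
    by (simp add: mpow_scaleR matrix_scalar_ac mpow_commute flip: scalar_matrix_assoc)
  then show ?thesis
    unfolding matrix_exp_def
    using bounded_linear.suminf[OF bl(1) summable_matrix_exp[of "t *\<^sub>R A"]]
      bounded_linear.suminf[OF bl(2) summable_matrix_exp[of "t *\<^sub>R A"]] by simp
qed

lemma matrix_exp_0 [simp]: "matrix_exp 0 = (mat 1 :: real^'n^'n)"
proof -
  have "matrix_exp (0 *\<^sub>R (0 :: real^'n^'n)) $ i $ j = mat 1 $ i $ j" for i j :: 'n
    by (rule sums_unique2[OF matrix_exp_entry_sums[of "0 :: real^'n^'n" i j 0]])
      (use powser_sums_zero[of "\<lambda>n. mpow (0 :: real^'n^'n) n $ i $ j / fact n"] in simp)
  then show ?thesis by (simp add: vec_eq_iff)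
qed

lemma has_vector_derivative_vecI:
  fixes f :: "real \<Rightarrow> 'a::real_normed_vector^'n"
  assumes "\<And>i. ((\<lambda>t. f t $ i) has_vector_derivative f' $ i) F"
  shows "(f has_vector_derivative f') F"
  using assms unfolding has_vector_derivative_def has_derivative_def
  by (auto intro!: vec_tendstoI bounded_linear_scaleR_left)

text \<open>Termwise differentiation of an entry cancels one factor of the factorial and leaves the
  power \<open>n + 1\<close> of \<open>A\<close> over \<open>fact n\<close>; splitting off the
  leftmost \<open>A\<close> then gives a row of \<open>A\<close> times the series again.\<close>

lemma matrix_exp_deriv:
  fixes A :: "real^'n^'n"
  shows "((\<lambda>t. matrix_exp (t *\<^sub>R A)) has_vector_derivative A ** matrix_exp (t *\<^sub>R A)) (at t within S)"
proof (rule has_vector_derivative_at_within, (rule has_vector_derivative_vecI)+,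
    unfold has_real_derivative_iff_has_vector_derivative[symmetric])
  fix i j
  let ?c = "\<lambda>k n. mpow A n $ k $ j / fact n"
  have eq: "(\<lambda>t. matrix_exp (t *\<^sub>R A) $ k $ j) = (\<lambda>t. \<Sum>n. ?c k n * t ^ n)" for k
    by (rule ext, rule sums_unique, rule matrix_exp_entry_sums)
  have d: "((\<lambda>t. \<Sum>n. ?c i n * t ^ n) has_real_derivative (\<Sum>n. diffs (?c i) n * t ^ n)) (at t)"
    by (intro termdiffs_strong_converges_everywhere sums_summable[OF matrix_exp_entry_sums])
  have "diffs (?c i) n * t ^ n = (\<Sum>k\<in>UNIV. A $ i $ k * (?c k n * t ^ n))" for n
  proof -
    have "diffs (?c i) n = mpow A (Suc n) $ i $ j / fact n"
      unfolding diffs_def fact_Suc by (simp del: of_nat_Suc funpow.simps)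
    also have "mpow A (Suc n) $ i $ j = (\<Sum>k\<in>UNIV. A $ i $ k * mpow A n $ k $ j)"
      by (simp add: matrix_matrix_mult_def)
    finally show ?thesis by (simp add: sum_divide_distrib sum_distrib_right mult.assoc)
  qed
  then have "(\<lambda>n. diffs (?c i) n * t ^ n) sums
      (\<Sum>k\<in>UNIV. A $ i $ k * matrix_exp (t *\<^sub>R A) $ k $ j)"
    by (simp only:) (intro sums_sum sums_mult matrix_exp_entry_sums)
  then have "(\<Sum>n. diffs (?c i) n * t ^ n) = (A ** matrix_exp (t *\<^sub>R A)) $ i $ j"
    by (simp add: matrix_matrix_mult_def sums_unique[symmetric])
  with d show "((\<lambda>t. matrix_exp (t *\<^sub>R A) $ i $ j) has_real_derivative
      (A ** matrix_exp (t *\<^sub>R A)) $ i $ j) (at t)"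
    by (simp only: eq)
qed

text \<open>The product of the exponentials of \<open>(a - b + t) *\<^sub>R A\<close> and
  \<open>(- t) *\<^sub>R A\<close> has derivative zero in \<open>t\<close>, since \<open>A\<close>
  commutes with its exponential. Its values at \<open>t = 0\<close> and \<open>t = b\<close> are the
  two sides.\<close>

lemma matrix_exp_diff:
  fixes A :: "real^'n^'n"
  shows "matrix_exp ((a - b) *\<^sub>R A) = matrix_exp (a *\<^sub>R A) ** matrix_exp ((- b) *\<^sub>R A)"
proof -
  let ?E = "\<lambda>t. matrix_exp (t *\<^sub>R A)" and ?c = "a - b"
  let ?F = "\<lambda>t. ?E (?c + t) ** ?E (- t)"
  have deriv: "(?F has_vector_derivative 0) (at t within UNIV)" for t
  proof -
    have 1: "((\<lambda>t. ?E (?c + t)) has_vector_derivative A ** ?E (?c + t)) (at t within UNIV)"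
      using vector_diff_chain_at[of "\<lambda>t. ?c + t" 1 t ?E, OF _ matrix_exp_deriv]
      by (simp add: o_def has_vector_derivative_add_const add.commute[of ?c] has_vector_derivative_id[unfolded id_def])
    have 2: "((\<lambda>t. ?E (- t)) has_vector_derivative - (A ** ?E (- t))) (at t within UNIV)"
      using vector_diff_chain_at[of "\<lambda>t. - t" "-1" t ?E, OF has_vector_derivative_minus[OF has_vector_derivative_id] matrix_exp_deriv]
      by (simp add: o_def)
    have "- (?E (?c + t) ** (A ** ?E (- t))) + (A ** ?E (?c + t)) ** ?E (- t) = 0"
      by (simp only: matrix_exp_commute[of A "?c + t"] matrix_mul_assoc left_minus)
    moreover have "?E (?c + t) ** - (A ** ?E (- t)) = - (?E (?c + t) ** (A ** ?E (- t)))"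
      by (rule bounded_bilinear.minus_right[OF bounded_bilinear_matrix_mult])
    ultimately show ?thesis
      using bounded_bilinear.has_vector_derivative[OF bounded_bilinear_matrix_mult 1 2] by (simp only:)
  qed
  obtain c where c: "\<And>t. t \<in> UNIV \<Longrightarrow> ?F t = c"
    using has_vector_derivative_zero_constant[OF convex_UNIV deriv] by metis
  have "?F 0 = ?F b" by (rule trans[OF c c[symmetric]]) (rule UNIV_I)+
  then show ?thesis
    by (simp only: add_0_right minus_zero scaleR_zero_left matrix_exp_0 matrix_mul_rid diff_add_cancel)
qed

section \<open>Orthonormal systems on the unit interval\<close>

text \<open>The nonlinearity along the numerical solution is at first only known to be absolutely
  integrable. A continuous factor is bounded and measurable on a compact interval and preserves
  that.\<close>

lemma absolutely_integrable_scaleR_continuous: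
  fixes f :: "real \<Rightarrow> 'b::euclidean_space"
  assumes "continuous_on {a..b} p" "f absolutely_integrable_on {a..b}"
  shows "(\<lambda>x. p x *\<^sub>R f x) absolutely_integrable_on {a..b}"
  by (rule absolutely_integrable_bounded_measurable_product[OF _ _ _ _ assms(2)])
    (auto intro!: bilinear_conv_bounded_bilinear[THEN iffD2] bounded_bilinear_scaleR assms(1)
      continuous_imp_measurable_on_sets_lebesgue compact_imp_bounded compact_continuous_image)

text \<open>This is the substitution \<open>s = \<xi> * \<tau>\<close>. With the factor \<tau> on
  the left, and not its inverse on the right, the degenerate case \<tau> = 0 is included.\<close>

lemma integral_scale_01:
  fixes F :: "real \<Rightarrow> 'b::euclidean_space"
  assumes "continuous_on {0..\<tau>} F" "0 \<le> \<tau>"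
  shows "\<tau> *\<^sub>R integral {0..1} (\<lambda>\<xi>. F (\<xi> * \<tau>)) = integral {0..\<tau>} F"
proof (cases "\<tau> = 0")
  case False
  then have "(\<lambda>x. x / \<tau>) ` {0..\<tau>} = {0..1}"
    using \<open>0 \<le> \<tau>\<close> by (auto simp: image_iff field_simps intro!: bexI[of _ "\<tau> * _"])
  moreover have "(F has_integral integral {0..\<tau>} F) {0..\<tau>}"
    using assms integrable_continuous_real by blast
  ultimately have "((\<lambda>x. F (\<tau> * x)) has_integral (1 / \<bar>\<tau>\<bar>) *\<^sub>R integral {0..\<tau>} F) {0..1}"
    using has_integral_stretch_real[of F _ 0 \<tau> \<tau>] False by metis
  then show ?thesis
    using False \<open>0 \<le> \<tau>\<close> by (simp add: mult.commute integral_unique)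
qed simp

text \<open>A single system for a fixed stepsize; continuity on the unit interval makes the
  integrals against absolutely integrable functions exist.\<close>

locale orthonormal_01 =
  fixes r :: nat and \<psi> :: "nat \<Rightarrow> real \<Rightarrow> real"
  assumes cont: "i < r \<Longrightarrow> continuous_on {0..1} (\<psi> i)"
    and ortho: "i < r \<Longrightarrow> j < r \<Longrightarrow>
      integral {0..1} (\<lambda>\<tau>. \<psi> i \<tau> * \<psi> j \<tau>) = (if i = j then 1 else 0)"
begin

definition coef :: "nat \<Rightarrow> (real \<Rightarrow> real^'d) \<Rightarrow> real^'d" where
  "coef i f = integral {0..1} (\<lambda>\<sigma>. \<psi> i \<sigma> *\<^sub>R f \<sigma>)"

lemma coef_integrable:
  fixes f :: "real \<Rightarrow> real^'d"
  assumes "f absolutely_integrable_on {0..1}" "i < r"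
  shows "(\<lambda>\<sigma>. \<psi> i \<sigma> *\<^sub>R f \<sigma>) integrable_on {0..1}"
  using absolutely_integrable_scaleR_continuous[OF cont assms(1)] assms(2)
  by (simp add: absolutely_integrable_on_def)

lemma continuous_on_combination: "continuous_on {0..1} (\<lambda>\<tau>. \<Sum>i<r. \<psi> i \<tau> *\<^sub>R W i)"
  for W :: "nat \<Rightarrow> real^'d"
  by (intro continuous_intros cont) simp

lemma proj_eq:
  fixes f :: "real \<Rightarrow> real^'d"
  assumes "f absolutely_integrable_on {0..1}"
  shows "proj r \<psi> f \<tau> = (\<Sum>i<r. \<psi> i \<tau> *\<^sub>R coef i f)"
proof -
  have "proj r \<psi> f \<tau> = integral {0..1} (\<lambda>\<sigma>. \<Sum>i<r. \<psi> i \<tau> *\<^sub>R (\<psi> i \<sigma> *\<^sub>R f \<sigma>))"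
    by (simp add: proj_def kernel_def scaleR_sum_left)
  also have "\<dots> = (\<Sum>i<r. integral {0..1} (\<lambda>\<sigma>. \<psi> i \<tau> *\<^sub>R (\<psi> i \<sigma> *\<^sub>R f \<sigma>)))"
    by (intro integral_sum integrable_cmul coef_integrable assms) auto
  finally show ?thesis by (simp only: integral_cmul coef_def)
qed

lemma continuous_on_proj:
  fixes f :: "real \<Rightarrow> real^'d"
  assumes "f absolutely_integrable_on {0..1}"
  shows "continuous_on {0..1} (proj r \<psi> f)"
  using continuous_on_combination[of "\<lambda>i. coef i f"] by (simp add: proj_eq[OF assms] cong: continuous_on_cong)

lemma coef_combination:
  fixes W :: "nat \<Rightarrow> real^'d"
  assumes "j < r"
  shows "coef j (\<lambda>\<tau>. \<Sum>i<r. \<psi> i \<tau> *\<^sub>R W i) = W j"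
proof -
  have i: "(\<lambda>\<tau>. \<psi> j \<tau> * \<psi> i \<tau>) integrable_on {0..1}" if "i < r" for i
    using assms that by (intro integrable_continuous_real continuous_intros cont)
  have "coef j (\<lambda>\<tau>. \<Sum>i<r. \<psi> i \<tau> *\<^sub>R W i) = integral {0..1} (\<lambda>\<tau>. \<Sum>i<r. (\<psi> j \<tau> * \<psi> i \<tau>) *\<^sub>R W i)"
    by (simp add: coef_def scaleR_sum_right)
  also have "\<dots> = (\<Sum>i<r. integral {0..1} (\<lambda>\<tau>. (\<psi> j \<tau> * \<psi> i \<tau>) *\<^sub>R W i))"
    by (rule integral_sum) (auto intro!: integrable_on_scaleR_left i)
  also have "\<dots> = (\<Sum>i<r. (if j = i then 1 else 0) *\<^sub>R W i)"
    using assms by (intro sum.cong refl) (simp add: integral_unique[OF has_integral_scaleR_left[OF integrable_integral[OF i]]] ortho)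
  also have "\<dots> = W j"
    using assms by (simp add: if_distrib[of "\<lambda>c. c *\<^sub>R _"] cong: if_cong)
  finally show ?thesis .
qed

lemma coef_residual:
  fixes f :: "real \<Rightarrow> real^'d"
  assumes f: "f absolutely_integrable_on {0..1}" and "j < r"
  shows "coef j (\<lambda>\<tau>. f \<tau> - proj r \<psi> f \<tau>) = 0"
proof -
  have "coef j (\<lambda>\<tau>. f \<tau> - proj r \<psi> f \<tau>) = coef j f - coef j (proj r \<psi> f)"
    unfolding coef_def scaleR_diff_right
    by (intro integral_diff coef_integrable absolutely_integrable_continuous_real
        continuous_on_proj assms)
  also have "coef j (proj r \<psi> f) = coef j f"
    using coef_combination[OF \<open>j < r\<close>, of "\<lambda>i. coef i f"] by (simp add: coef_def proj_eq[OF f])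
  finally show ?thesis by simp
qed

lemma residual_absolutely_integrable:
  fixes f :: "real \<Rightarrow> real^'d"
  assumes "f absolutely_integrable_on {0..1}"
  shows "(\<lambda>\<tau>. f \<tau> - proj r \<psi> f \<tau>) absolutely_integrable_on {0..1}"
  by (intro set_integral_diff assms absolutely_integrable_continuous_real continuous_on_proj)

text \<open>The residual has vanishing coefficients, and a constant matrix commutes with the scalar
  functions \<open>\<psi> j\<close>, so orthogonality survives the insertion of \<open>L\<close>.
  The energy argument takes \<open>L\<close> to be the inverse of \<open>Q\<close>, the contraction
  property takes the identity.\<close>

lemma has_integral_residual_combination:
  fixes f :: "real \<Rightarrow> real^'d" and L :: "real^'d^'d"
  assumes f: "f absolutely_integrable_on {0..1}"
  shows "((\<lambda>\<tau>. (L *v (f \<tau> - proj r \<psi> f \<tau>)) \<bullet> (\<Sum>j<r. \<psi> j \<tau> *\<^sub>R W j)) has_integral 0) {0..1}"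
proof -
  let ?e = "\<lambda>\<tau>. f \<tau> - proj r \<psi> f \<tau>"
  have "((\<lambda>\<tau>. (L *v (\<psi> j \<tau> *\<^sub>R ?e \<tau>)) \<bullet> W j) has_integral 0) {0..1}" if "j < r" for j
  proof -
    have "((\<lambda>\<tau>. \<psi> j \<tau> *\<^sub>R ?e \<tau>) has_integral 0) {0..1}"
      using coef_integrable[OF residual_absolutely_integrable[OF f] that] coef_residual[OF f that]
      by (simp add: coef_def has_integral_iff)
    moreover have "bounded_linear (\<lambda>v. (L *v v) \<bullet> W j)"
      by (rule bounded_linear_compose[OF bounded_linear_inner_left matrix_vector_mul_bounded_linear])
    ultimately show ?thesis
      using has_integral_linear[of "\<lambda>\<tau>. \<psi> j \<tau> *\<^sub>R ?e \<tau>" 0 "{0..1}" "\<lambda>v. (L *v v) \<bullet> W j"]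
      by (simp add: o_def)
  qed
  then have "((\<lambda>\<tau>. \<Sum>j<r. (L *v (\<psi> j \<tau> *\<^sub>R ?e \<tau>)) \<bullet> W j) has_integral (\<Sum>j<r. 0)) {0..1}"
    by (intro has_integral_sum) auto
  then show ?thesis
    by (simp add: inner_sum_right matrix_vector_mult_scaleR)
qed

lemma residual_norm_le:
  fixes f :: "real \<Rightarrow> real^'d"
  assumes f: "continuous_on {0..1} f"
  shows "integral {0..1} (\<lambda>\<tau>. (norm (f \<tau> - proj r \<psi> f \<tau>))\<^sup>2) \<le> integral {0..1} (\<lambda>\<tau>. (norm (f \<tau>))\<^sup>2)"
proof -
  let ?e = "\<lambda>\<tau>. f \<tau> - proj r \<psi> f \<tau>"
  have f': "f absolutely_integrable_on {0..1}"
    by (rule absolutely_integrable_continuous_real[OF f])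
  note cp = continuous_on_proj[OF f']
  have e2: "(\<lambda>\<tau>. (norm (?e \<tau>))\<^sup>2) integrable_on {0..1}"
    by (intro integrable_continuous_real continuous_intros f cp)
  have "((\<lambda>\<tau>. ?e \<tau> \<bullet> proj r \<psi> f \<tau>) has_integral 0) {0..1}"
    using has_integral_residual_combination[OF f', of "mat 1" "\<lambda>i. coef i f"]
    by (simp add: proj_eq[OF f'])
  \<comment> \<open>Adding twice the cross term, whose integral is zero, reduces the claim to a
    pointwise inequality between integrands.\<close>
  from has_integral_add[OF integrable_integral[OF e2] has_integral_cmul[OF this, of 2]]
  have *: "((\<lambda>\<tau>. (norm (?e \<tau>))\<^sup>2 + 2 * (?e \<tau> \<bullet> proj r \<psi> f \<tau>)) has_integral
      integral {0..1} (\<lambda>\<tau>. (norm (?e \<tau>))\<^sup>2)) {0..1}" by simp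
  show ?thesis
  proof (rule has_integral_le[OF * integrable_integral])
    show "(\<lambda>\<tau>. (norm (f \<tau>))\<^sup>2) integrable_on {0..1}"
      by (intro integrable_continuous_real continuous_intros f)
    fix \<tau> :: real
    have "(norm (x + y))\<^sup>2 = (norm x)\<^sup>2 + 2 * (x \<bullet> y) + (norm y)\<^sup>2" for x y :: "real^'d"
      unfolding power2_norm_eq_inner by (simp add: inner_add inner_commute)
    from this[of "?e \<tau>" "proj r \<psi> f \<tau>"] show "(norm (?e \<tau>))\<^sup>2 + 2 * (?e \<tau> \<bullet> proj r \<psi> f \<tau>) \<le> (norm (f \<tau>))\<^sup>2" by simp
  qed
qed

section \<open>The differential equation of the method\<close>

text \<open>The kernel is a finite sum of products, so the double integral separates and the method
  becomes a variation-of-constants formula whose forcing term \<open>p\<close> is the projection of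
  \<open>G\<close>. This term is continuous even if \<open>G\<close> is merely integrable, hence the
  fundamental theorem of calculus applies.\<close>

lemma ECr_solution_deriv:
  fixes A :: "real^'d^'d"
  assumes u: "ECr_solution h (kernel r \<psi>) A g y0 u" and \<tau>: "\<tau> \<in> {0..1}"
  shows "(u has_vector_derivative h *\<^sub>R (A *v u \<tau> + proj r \<psi> (\<lambda>\<sigma>. g (u \<sigma>)) \<tau>)) (at \<tau> within {0..1})"
proof -
  define G where "G = (\<lambda>\<sigma>. g (u \<sigma>))"
  define E where "E t = matrix_exp (t *\<^sub>R A)" for t
  define p where "p = (\<lambda>\<tau>. \<Sum>i<r. \<psi> i \<tau> *\<^sub>R coef i G)"
  have G: "G absolutely_integrable_on {0..1}"
    using u by (simp add: ECr_solution_def G_def)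
  have Ed: "(E has_vector_derivative A ** E t) (at t within S)" for t S
    unfolding E_def by (rule matrix_exp_deriv)
  have Ec: "continuous_on S E" for S
    using has_vector_derivative_continuous[OF Ed] by (auto simp: continuous_on_eq_continuous_within)
  note Ec' = continuous_on_compose2[OF Ec[of UNIV] _ subset_UNIV]
  note mv = bounded_bilinear.continuous_on[OF bounded_bilinear_matrix_vector_mult]
  have pc: "continuous_on {0..1} p"
    unfolding p_def by (rule continuous_on_combination)
  \<comment> \<open>With \<open>E (t * h)\<close> pulled out in front, \<open>t\<close> enters the
    integral only through its upper limit.\<close>
  have ueq: "u t = E (t * h) *v (y0 + h *\<^sub>R integral {0..t} (\<lambda>s. E (- (s * h)) *v p s))"
    if t: "t \<in> {0..1}" for t
  proof -
    \<comment> \<open>For fixed \<open>t\<close> the matrix kernel is a combination of the functions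
      \<open>\<psi> i\<close> of \<sigma> with matrix coefficients \<open>B i\<close>; integrating
      over \<sigma> therefore produces only the coefficients of \<open>G\<close>.\<close>
    define B where "B i = integral {0..1} (\<lambda>\<xi>. \<psi> i (\<xi> * t) *\<^sub>R E ((1 - \<xi>) * t * h))" for i
    have Bi: "(\<lambda>\<xi>. \<psi> i (\<xi> * t) *\<^sub>R E ((1 - \<xi>) * t * h)) integrable_on {0..1}" if "i < r" for i
      by (intro integrable_continuous_real continuous_intros Ec' continuous_on_compose2[OF cont[OF that]])
        (use t in \<open>auto intro: mult_le_one\<close>)
    have "Abar h (kernel r \<psi>) A t \<sigma>
        = integral {0..1} (\<lambda>\<xi>. \<Sum>i<r. \<psi> i \<sigma> *\<^sub>R (\<psi> i (\<xi> * t) *\<^sub>R E ((1 - \<xi>) * t * h)))" for \<sigma>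
      by (simp add: Abar_def kernel_def E_def scaleR_sum_left mult.commute)
    then have "Abar h (kernel r \<psi>) A t \<sigma> = (\<Sum>i<r. \<psi> i \<sigma> *\<^sub>R B i)" for \<sigma>
      by (subst (asm) integral_sum) (auto simp only: B_def integral_cmul lessThan_iff
          finite_lessThan intro!: integrable_cmul Bi)
    then have "integral {0..1} (\<lambda>\<sigma>. Abar h (kernel r \<psi>) A t \<sigma> *v G \<sigma>)
        = integral {0..1} (\<lambda>\<sigma>. \<Sum>i<r. B i *v (\<psi> i \<sigma> *\<^sub>R G \<sigma>))"
      by (simp add: bounded_bilinear.sum_left[OF bounded_bilinear_matrix_vector_mult]
          matrix_vector_mult_scaleR scaleR_matrix_vector_assoc)
    also have "\<dots> = (\<Sum>i<r. integral {0..1} (\<lambda>\<sigma>. B i *v (\<psi> i \<sigma> *\<^sub>R G \<sigma>)))"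
      by (intro integral_sum)
        (auto intro!: integrable_linear[OF coef_integrable[OF G], unfolded o_def])
    also have "\<dots> = (\<Sum>i<r. B i *v coef i G)"
      by (intro sum.cong refl)
        (simp add: coef_def integral_linear[OF coef_integrable[OF G], unfolded o_def])
    also have "\<dots> = (\<Sum>i<r. integral {0..1} (\<lambda>\<xi>. (\<psi> i (\<xi> * t) *\<^sub>R E ((1 - \<xi>) * t * h)) *v coef i G))"
      using integral_linear[OF Bi
          bounded_bilinear.bounded_linear_left[OF bounded_bilinear_matrix_vector_mult], unfolded o_def]
      by (intro sum.cong refl) (simp add: B_def)
    also have "\<dots> = integral {0..1} (\<lambda>\<xi>. \<Sum>i<r. (\<psi> i (\<xi> * t) *\<^sub>R E ((1 - \<xi>) * t * h)) *v coef i G)"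
      by (intro integral_sum[symmetric])
        (auto intro!: integrable_linear[OF Bi bounded_bilinear.bounded_linear_left
            [OF bounded_bilinear_matrix_vector_mult], unfolded o_def])
    also have "\<dots> = integral {0..1} (\<lambda>\<xi>. E ((t - \<xi> * t) * h) *v p (\<xi> * t))"
      by (simp add: p_def vec.sum matrix_vector_mult_scaleR scaleR_matrix_vector_assoc[symmetric]
          left_diff_distrib)
    finally have "t *\<^sub>R integral {0..1} (\<lambda>\<sigma>. Abar h (kernel r \<psi>) A t \<sigma> *v G \<sigma>)
        = t *\<^sub>R integral {0..1} (\<lambda>\<xi>. E ((t - \<xi> * t) * h) *v p (\<xi> * t))" by simp
    also have "\<dots> = integral {0..t} (\<lambda>s. E ((t - s) * h) *v p s)"
      using t by (intro integral_scale_01 mv Ec' continuous_intros continuous_on_subset[OF pc]) auto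
    also have "\<dots> = integral {0..t} (\<lambda>s. E (t * h) *v (E (- (s * h)) *v p s))"
      unfolding E_def left_diff_distrib matrix_exp_diff[of "t * h"] matrix_vector_mul_assoc ..
    also have "\<dots> = E (t * h) *v integral {0..t} (\<lambda>s. E (- (s * h)) *v p s)"
      using t by (intro integral_linear[unfolded o_def] integrable_continuous_real mv Ec'
          continuous_intros continuous_on_subset[OF pc]) auto
    finally have *: "t *\<^sub>R integral {0..1} (\<lambda>\<sigma>. Abar h (kernel r \<psi>) A t \<sigma> *v G \<sigma>) = \<dots>" .
    have "u t = E (t * h) *v y0 + h *\<^sub>R (t *\<^sub>R integral {0..1} (\<lambda>\<sigma>. Abar h (kernel r \<psi>) A t \<sigma> *v G \<sigma>))"
      using u t by (simp add: ECr_solution_def G_def E_def mult.commute)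
    then show ?thesis
      unfolding * by (simp add: matrix_vector_right_distrib matrix_vector_mult_scaleR)
  qed
  let ?I = "\<lambda>t. y0 + h *\<^sub>R integral {0..t} (\<lambda>s. E (- (s * h)) *v p s)"
  have "((\<lambda>t. integral {0..t} (\<lambda>s. E (- (s * h)) *v p s)) has_vector_derivative
      E (- (\<tau> * h)) *v p \<tau>) (at \<tau> within {0..1})"
    using \<tau> by (intro integral_has_vector_derivative mv Ec' continuous_intros pc)
  then have dI: "(?I has_vector_derivative h *\<^sub>R (E (- (\<tau> * h)) *v p \<tau>)) (at \<tau> within {0..1})"
    by (auto intro!: derivative_eq_intros)
  have dE: "((\<lambda>t. E (t * h)) has_vector_derivative h *\<^sub>R (A ** E (\<tau> * h))) (at \<tau> within {0..1})"
  proof -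
    have "((\<lambda>t. t * h) has_vector_derivative h) (at \<tau> within {0..1})"
      by (auto intro!: derivative_eq_intros)
    from vector_diff_chain_within[OF this Ed] show ?thesis by (simp add: o_def)
  qed
  have "E (\<tau> * h) ** E (- (\<tau> * h)) = mat 1"
    unfolding E_def using matrix_exp_diff[of "\<tau> * h" "\<tau> * h" A] by simp
  then have eq: "E (\<tau> * h) *v (h *\<^sub>R (E (- (\<tau> * h)) *v p \<tau>)) + (h *\<^sub>R (A ** E (\<tau> * h))) *v ?I \<tau>
      = h *\<^sub>R (A *v u \<tau> + p \<tau>)"
    unfolding ueq[OF \<tau>]
    by (simp add: matrix_vector_mult_scaleR matrix_vector_mul_assoc scaleR_add_right
        scaleR_matrix_vector_assoc[symmetric])
  have "((\<lambda>t. E (t * h) *v ?I t) has_vector_derivative h *\<^sub>R (A *v u \<tau> + p \<tau>)) (at \<tau> within {0..1})"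
    using bounded_bilinear.has_vector_derivative[OF bounded_bilinear_matrix_vector_mult dE dI]
    unfolding eq .
  then have "(u has_vector_derivative h *\<^sub>R (A *v u \<tau> + p \<tau>)) (at \<tau> within {0..1})"
    by (rule has_vector_derivative_transform[OF \<tau> ueq, rotated])
  then show ?thesis by (simp add: p_def proj_eq[OF G] flip: G_def)
qed

lemma ECr_solution_0:
  assumes "ECr_solution h (kernel r \<psi>) A g y0 u"
  shows "u 0 = y0"
  using assms by (simp add: ECr_solution_def)

end

section \<open>Energy balance\<close>

text \<open>Since \<open>grad\<close> is a definite description, uniqueness is what gives access to
  its value.\<close>

lemma GDERIV_unique:
  assumes "GDERIV f x :> D" "GDERIV f x :> E"
  shows "D = E"
proof -
  have "(\<lambda>h. h \<bullet> D) = (\<lambda>h. h \<bullet> E)"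
    using assms unfolding gderiv_def by (rule has_derivative_unique)
  then have "\<forall>h. h \<bullet> D = h \<bullet> E" by (metis fun_cong)
  then show ?thesis by (rule vector_eq_ldot[THEN iffD1])
qed

lemma grad_eqI:
  assumes "GDERIV f x :> D"
  shows "grad f x = D"
  unfolding grad_def using assms GDERIV_unique[OF _ assms] by (rule the_equality)

text \<open>Riesz representation: the adjoint of the derivative, applied to 1, is the representing
  vector.\<close>

lemma GDERIV_grad:
  fixes f :: "'a::euclidean_space \<Rightarrow> real"
  assumes "f differentiable (at x)"
  shows "GDERIV f x :> grad f x"
proof -
  obtain f' where f': "(f has_derivative f') (at x)"
    using assms by (auto simp: differentiable_def)
  then have "linear f'" using has_derivative_bounded_linear bounded_linear.linear by blast
  then have "f' = (\<lambda>h. h \<bullet> adjoint f' 1)"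
    using adjoint_works[of f' _ 1] by (simp add: fun_eq_iff)
  then have "GDERIV f x :> adjoint f' 1"
    using f' unfolding gderiv_def by (simp only:)
  then show ?thesis by (simp only: grad_eqI)
qed

lemma inner_matrix_transpose: "(A *v x) \<bullet> y = x \<bullet> (transpose A *v y)"
  for A :: "real^'n^'n"
  by (metis dot_lmul_matrix inner_commute transpose_matrix_vector)

lemma skew_inner_self:
  fixes Q :: "real^'n^'n"
  assumes "transpose Q = - Q"
  shows "(Q *v x) \<bullet> x = 0"
proof -
  have "(Q *v x) \<bullet> x = x \<bullet> (- Q *v x)"
    by (simp add: inner_matrix_transpose assms)
  also have "\<dots> = - ((Q *v x) \<bullet> x)"
    by (simp add: bounded_bilinear.minus_left[OF bounded_bilinear_matrix_vector_mult] inner_commute)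
  finally show ?thesis by simp
qed

lemma matrix_inv_vector:
  fixes Q :: "real^'n^'n"
  assumes "invertible Q"
  shows "matrix_inv Q *v (Q *v x) = x" "Q *v (matrix_inv Q *v x) = x"
proof -
  have "Q ** matrix_inv Q = mat 1 \<and> matrix_inv Q ** Q = mat 1"
    unfolding matrix_inv_def using assms unfolding invertible_def by (rule someI_ex)
  then show "matrix_inv Q *v (Q *v x) = x" "Q *v (matrix_inv Q *v x) = x"
    by (simp_all add: matrix_vector_mul_assoc)
qed

lemma GDERIV_energy:
  fixes V :: "real^'d \<Rightarrow> real"
  assumes "transpose M = M" "V differentiable (at y)"
  shows "GDERIV (energy M V) y :> M *v y + grad V y"
proof -
  have "((\<lambda>y. 1/2 * (y \<bullet> (M *v y))) has_derivative (\<lambda>h. 1/2 * (y \<bullet> (M *v h) + h \<bullet> (M *v y)))) (at y)"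
    by (intro has_derivative_mult_right has_derivative_inner has_derivative_ident
        bounded_linear_imp_has_derivative matrix_vector_mul_bounded_linear)
  moreover have "y \<bullet> (M *v h) = h \<bullet> (M *v y)" for h
    using inner_matrix_transpose[of M h y] assms(1) by (simp add: inner_commute)
  ultimately have "GDERIV (\<lambda>y. 1/2 * (y \<bullet> (M *v y))) y :> M *v y"
    by (simp add: gderiv_def)
  from GDERIV_add[OF this GDERIV_grad[OF assms(2)]] show ?thesis
    by (simp add: energy_def[abs_def])
qed

lemma has_vector_derivative_along:
  assumes "GDERIV H (y t) :> D" "(y has_vector_derivative d) (at t within T)"
  shows "((\<lambda>t. H (y t)) has_vector_derivative d \<bullet> D) (at t within T)"
  using vector_derivative_diff_chain_within[OF assms(2)
      has_derivative_at_withinI[OF assms(1)[unfolded gderiv_def]]]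
  unfolding o_def .

text \<open>Along a solution the derivative of the energy is the inner product of
  \<open>Q *v grad H\<close> with \<open>grad H\<close>, which vanishes by skewness; on an interval
  a vanishing derivative forces a constant.\<close>

lemma first_integral_energy:
  fixes Q M :: "real^'d^'d"
  assumes "transpose Q = - Q" "transpose M = M" "\<And>y. V differentiable (at y)"
  shows "first_integral (\<lambda>y. Q *v grad (energy M V) y) (energy M V)"
  unfolding first_integral_def
proof (intro allI impI ballI, elim conjE)
  fix T :: "real set" and y s t
  assume T: "is_interval T" "s \<in> T" "t \<in> T"
    and y: "\<forall>t\<in>T. (y has_vector_derivative Q *v grad (energy M V) (y t)) (at t within T)"
  let ?H = "energy M V"
  have "((\<lambda>t. ?H (y t)) has_vector_derivative 0) (at t within T)" if "t \<in> T" for t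
  proof -
    have "GDERIV ?H (y t) :> grad ?H (y t)"
      using grad_eqI[OF GDERIV_energy[OF assms(2,3)]] GDERIV_energy[OF assms(2,3)] by (simp only:)
    from has_vector_derivative_along[where y = y, OF this y[rule_format, OF that]]
    show ?thesis by (simp add: skew_inner_self[OF assms(1)])
  qed
  then obtain c where "\<And>t. t \<in> T \<Longrightarrow> ?H (y t) = c"
    using has_vector_derivative_zero_constant[OF is_interval_convex[OF T(1)], of "\<lambda>t. ?H (y t)"] by blast
  with T show "?H (y s) = ?H (y t)" by simp
qed

text \<open>Let \<open>v\<close> be the bracket in the equation for \<open>u\<close> and
  \<open>e\<close> the difference between the exact nonlinearity and \<open>p\<close>. The gradient
  of the energy is the inverse of \<open>Q\<close> applied to \<open>v + e\<close>, and its inner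
  product with \<open>h *\<^sub>R v\<close> retains only the contribution of
  \<open>e\<close>.\<close>

lemma energy_balance:
  fixes Q M :: "real^'d^'d" and V :: "real^'d \<Rightarrow> real" and u p :: "real \<Rightarrow> real^'d"
  assumes Q: "invertible Q" "transpose Q = - Q" and M: "transpose M = M"
    and V: "\<And>y. V differentiable (at y)"
    and u: "\<And>\<tau>. \<tau> \<in> {0..1} \<Longrightarrow>
      (u has_vector_derivative h *\<^sub>R ((Q ** M) *v u \<tau> + p \<tau>)) (at \<tau> within {0..1})"
  shows "((\<lambda>\<tau>. h * ((matrix_inv Q *v (Q *v grad V (u \<tau>) - p \<tau>)) \<bullet> ((Q ** M) *v u \<tau> + p \<tau>)))
    has_integral (energy M V (u 1) - energy M V (u 0))) {0..1}"
proof (rule fundamental_theorem_of_calculus)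
  fix \<tau> :: real assume \<tau>: "\<tau> \<in> {0..1}"
  let ?v = "(Q ** M) *v u \<tau> + p \<tau>" and ?e = "Q *v grad V (u \<tau>) - p \<tau>"
  have "M *v u \<tau> + grad V (u \<tau>) = matrix_inv Q *v (?v + ?e)"
    by (simp add: matrix_vector_right_distrib matrix_inv_vector[OF Q(1)]
        flip: matrix_vector_mul_assoc)
  \<comment> \<open>The inverse of \<open>Q\<close> inherits the skewness: the quadratic form of
    \<open>Q\<close> is evaluated at the preimage of \<open>?v\<close>.\<close>
  moreover have "?v \<bullet> (matrix_inv Q *v ?v) = 0"
    using skew_inner_self[OF Q(2), of "matrix_inv Q *v ?v"] by (simp add: matrix_inv_vector[OF Q(1)])
  moreover have "(h *\<^sub>R v) \<bullet> (B *v (v + e)) = h * ((B *v e) \<bullet> v)" if "v \<bullet> (B *v v) = 0"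
    for v e :: "real^'d" and B
    using that by (simp add: matrix_vector_right_distrib inner_add_right inner_commute)
  ultimately have "(h *\<^sub>R ?v) \<bullet> (M *v u \<tau> + grad V (u \<tau>)) = h * ((matrix_inv Q *v ?e) \<bullet> ?v)"
    by (simp only:)
  with has_vector_derivative_along[where y = u, OF GDERIV_energy[OF M V] u[OF \<tau>]]
  show "((\<lambda>\<tau>. energy M V (u \<tau>)) has_vector_derivative h * ((matrix_inv Q *v ?e) \<bullet> ?v)) (at \<tau> within {0..1})"
    by (simp only:)
qed simp

section \<open>Graded expansions in the stepsize\<close>

text \<open>The outer variable of a bivariate polynomial is the stepsize, the inner one is \<open>\<tau>\<close>; a regular
  function has a Taylor polynomial satisfying \<open>graded 0\<close>.\<close>

definition ev :: "real poly poly \<Rightarrow> real \<Rightarrow> real \<Rightarrow> real" where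
  "ev F h \<tau> = poly (poly F [:h:]) \<tau>"

text \<open>The slack \<open>s\<close> accounts for differentiation in the stepsize, which lowers
  the power of \<open>h\<close> without having to lower the degree in \<tau>; integration in the
  stepsize removes it again.\<close>

definition graded :: "nat \<Rightarrow> real poly poly \<Rightarrow> bool" where
  "graded s F \<longleftrightarrow> (\<forall>n. degree (coeff F n) \<le> n + s)"

definition evv :: "('d \<Rightarrow> real poly poly) \<Rightarrow> real \<Rightarrow> real \<Rightarrow> real^'d" where
  "evv W h \<tau> = (\<chi> j. ev (W j) h \<tau>)"

lemma ev_0 [simp]: "ev 0 h \<tau> = 0"
  and ev_pCons [simp]: "ev (pCons a F) h \<tau> = poly a \<tau> + h * ev F h \<tau>"
  and ev_add: "ev (F + G) h \<tau> = ev F h \<tau> + ev G h \<tau>"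
  and ev_mult: "ev (F * G) h \<tau> = ev F h \<tau> * ev G h \<tau>"
  by (simp_all add: ev_def)

lemma ev_sum: "ev (\<Sum>i\<in>I. F i) h \<tau> = (\<Sum>i\<in>I. ev (F i) h \<tau>)"
  by (simp add: ev_def poly_sum)

lemma ev_at_0: "ev F 0 \<tau> = poly (coeff F 0) \<tau>"
  by (cases F) simp

lemma evv_nth [simp]: "evv W h \<tau> $ j = ev (W j) h \<tau>"
  by (simp add: evv_def)

lemma continuous_on_ev: "continuous_on S (\<lambda>x. ev F (fst x) (snd x))"
  by (induction F) (auto intro!: continuous_intros)

lemma continuous_on_ev_snd: "continuous_on S (ev F h)"
  unfolding ev_def[abs_def] by (intro continuous_intros)

lemma continuous_on_evv: "continuous_on S (evv W h)"
  unfolding evv_def[abs_def] by (intro continuous_on_vec_lambda continuous_on_ev_snd)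

lemma ev_bounded: "\<exists>C\<ge>0. \<forall>h\<in>{0..1}. \<forall>\<tau>\<in>{0..1}. \<bar>ev F h \<tau>\<bar> \<le> C"
proof -
  have "compact ((\<lambda>x. ev F (fst x) (snd x)) ` ({0..1} \<times> {0..1}))"
    by (intro compact_continuous_image continuous_on_ev compact_Times) auto
  then obtain C where "C > 0" "\<forall>x\<in>(\<lambda>x. ev F (fst x) (snd x)) ` ({0..1} \<times> {0..1}). norm x \<le> C"
    using compact_imp_bounded bounded_pos by blast
  then show ?thesis by (intro exI[of _ C]) auto
qed

lemma ev_deriv_h: "((\<lambda>h. ev F h \<tau>) has_real_derivative ev (pderiv F) h \<tau>) (at h within S)"
proof (induction F)
  case (pCons a F)
  show ?case
    by (auto intro!: derivative_eq_intros pCons.IH simp: pderiv_pCons ev_add)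
qed simp

lemma evv_deriv_h: "((\<lambda>h. evv W h \<tau>) has_vector_derivative evv (\<lambda>j. pderiv (W j)) h \<tau>) (at h within S)"
  by (rule has_vector_derivative_vecI)
    (simp add: ev_deriv_h flip: has_real_derivative_iff_has_vector_derivative)

lemma graded_add: "graded s F \<Longrightarrow> graded s G \<Longrightarrow> graded s (F + G)"
  by (simp add: graded_def degree_add_le)

lemma graded_0: "graded s 0"
  by (simp add: graded_def)

lemma graded_sum: "(\<And>i. i \<in> I \<Longrightarrow> graded s (F i)) \<Longrightarrow> graded s (\<Sum>i\<in>I. F i)"
  by (induction I rule: infinite_finite_induct) (simp_all add: graded_add graded_0)

text \<open>The coefficient of the n-th power of \<open>h\<close> pairs the indices \<open>i\<close>
  and \<open>n - i\<close>, so the indices recombine to \<open>n\<close> and the two slacks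
  add.\<close>

lemma graded_mult:
  assumes "graded s F" "graded t G"
  shows "graded (s + t) (F * G)"
  unfolding graded_def coeff_mult
proof (intro allI degree_sum_le)
  fix n i :: nat assume "i \<in> {..n}"
  have "degree (coeff F i * coeff G (n - i)) \<le> degree (coeff F i) + degree (coeff G (n - i))"
    by (rule degree_mult_le)
  also have "\<dots> \<le> (i + s) + ((n - i) + t)"
    using assms by (intro add_mono) (auto simp: graded_def)
  finally show "degree (coeff F i * coeff G (n - i)) \<le> n + (s + t)"
    using \<open>i \<in> {..n}\<close> by simp
qed simp

lemma graded_pderiv:
  assumes "graded s F"
  shows "graded (Suc s) (pderiv F)"
  unfolding graded_def
proof
  fix n
  have "degree (coeff (pderiv F) n) \<le> degree (coeff F (Suc n))"
    unfolding coeff_pderiv of_nat_poly by (simp del: of_nat_Suc)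
  also have "\<dots> \<le> Suc n + s"
    using assms unfolding graded_def by blast
  finally show "degree (coeff (pderiv F) n) \<le> n + Suc s" by simp
qed

text \<open>Integration in the stepsize shifts the coefficients by one place and rescales them,
  which keeps their degrees in \<tau>. The constant of integration \<open>c\<close> is itself a
  polynomial in \<tau>.\<close>

lemma antiderivative_h:
  fixes F :: "real poly poly"
  obtains G where "pderiv G = F" "coeff G 0 = c" "\<And>n. degree (coeff G (Suc n)) \<le> degree (coeff F n)"
proof -
  let ?c = "\<lambda>n. case n of 0 \<Rightarrow> c | Suc n \<Rightarrow> smult (1 / real (Suc n)) (coeff F n)"
  have "coeff (Abs_poly ?c) = ?c"
    by (rule coeff_Abs_poly[of "Suc (degree F)"]) (auto split: nat.split simp: coeff_eq_0)
  then show ?thesis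
    by (intro that[of "Abs_poly ?c"])
      (auto simp: poly_eq_iff coeff_pderiv of_nat_poly degree_smult_le simp del: of_nat_Suc)
qed

section \<open>Antiderivatives in \<tau> that vanish at 0\<close>

definition pint :: "real poly \<Rightarrow> real poly" where
  "pint p = Abs_poly (\<lambda>n. case n of 0 \<Rightarrow> 0 | Suc n \<Rightarrow> coeff p n / real (Suc n))"

lemma coeff_pint: "coeff (pint p) n = (case n of 0 \<Rightarrow> 0 | Suc n \<Rightarrow> coeff p n / real (Suc n))"
  unfolding pint_def
  by (subst coeff_Abs_poly[of "Suc (degree p)"]) (auto split: nat.split simp: coeff_eq_0)

lemma pint_0 [simp]: "pint 0 = 0"
  by (simp add: poly_eq_iff coeff_pint split: nat.split)

lemma pderiv_pint [simp]: "pderiv (pint p) = p"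
  by (simp add: poly_eq_iff coeff_pderiv coeff_pint del: of_nat_Suc)

lemma poly_pint_0 [simp]: "poly (pint p) 0 = 0"
  by (simp add: poly_0_coeff_0 coeff_pint)

lemma degree_pint_le: "degree (pint p) \<le> Suc (degree p)"
  by (rule degree_le) (auto simp: coeff_pint coeff_eq_0 split: nat.split)

lemma ev_map_pint_0: "ev (map_poly pint F) h 0 = 0"
  by (induction F) (simp_all add: map_poly_pCons)

lemma ev_map_pint_deriv:
  "((\<lambda>\<tau>. ev (map_poly pint F) h \<tau>) has_real_derivative ev F h \<tau>) (at \<tau> within S)"
proof (induction F)
  case (pCons a F)
  have "(poly (pint a) has_real_derivative poly a \<tau>) (at \<tau> within S)"
    using has_field_derivative_at_within[OF poly_DERIV[of "pint a" \<tau>]] by simp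
  then show ?case
    by (auto intro!: derivative_eq_intros pCons.IH simp: map_poly_pCons algebra_simps)
qed simp

text \<open>Integration in \<tau> raises every degree by one, and \<open>pCons\<close> raises the
  accompanying power of \<open>h\<close> by one as well. The expression is the initial value plus
  \<open>h\<close> times an integral, the shape of the integrated differential equation.\<close>

lemma graded_pCons_map_pint:
  assumes "graded 0 F"
  shows "graded 0 (pCons [:c:] (map_poly pint F))"
  unfolding graded_def
proof
  fix n
  show "degree (coeff (pCons [:c:] (map_poly pint F)) n) \<le> n + 0"
  proof (cases n)
    case (Suc m)
    have "degree (pint (coeff F m)) \<le> Suc (degree (coeff F m))" by (rule degree_pint_le)
    also have "\<dots> \<le> Suc m" using assms by (simp add: graded_def)
    finally show ?thesis by (simp add: Suc coeff_map_poly)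
  qed simp
qed

text \<open>After splitting off the lowest coefficient, the remainder of order \<open>k + 1\<close>
  is \<open>h\<close> times the remainder of order \<open>k\<close> of the tail.\<close>

lemma ev_taylor_remainder:
  "\<exists>C. \<forall>h\<in>{0..1}. \<forall>\<tau>\<in>{0..1}. \<bar>ev F h \<tau> - (\<Sum>n<k. h ^ n * poly (coeff F n) \<tau>)\<bar> \<le> C * h ^ k"
proof (induction k arbitrary: F)
  case 0
  show ?case using ev_bounded[of F] by auto
next
  case (Suc k)
  obtain a G where F: "F = pCons a G" by (cases F)
  obtain C where C: "\<forall>h\<in>{0..1}. \<forall>\<tau>\<in>{0..1}. \<bar>ev G h \<tau> - (\<Sum>n<k. h ^ n * poly (coeff G n) \<tau>)\<bar> \<le> C * h ^ k"
    using Suc.IH by blast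
  have "\<bar>ev F h \<tau> - (\<Sum>n<Suc k. h ^ n * poly (coeff F n) \<tau>)\<bar> \<le> C * h ^ Suc k"
    if "h \<in> {0..1}" "\<tau> \<in> {0..1}" for h \<tau>
  proof -
    have "(\<Sum>n<Suc k. h ^ n * poly (coeff F n) \<tau>)
        = poly a \<tau> + h * (\<Sum>n<k. h ^ n * poly (coeff G n) \<tau>)"
      unfolding F sum.lessThan_Suc_shift by (simp add: sum_distrib_left mult.assoc)
    then have "ev F h \<tau> - (\<Sum>n<Suc k. h ^ n * poly (coeff F n) \<tau>)
        = h * (ev G h \<tau> - (\<Sum>n<k. h ^ n * poly (coeff G n) \<tau>))"
      unfolding F by (simp add: right_diff_distrib)
    also have "\<bar>\<dots>\<bar> \<le> h * (C * h ^ k)"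
      unfolding abs_mult using C that by (intro mult_mono) auto
    finally show ?thesis by (simp add: mult_ac)
  qed
  then show ?case by blast
qed

section \<open>Calculus of the uniform order symbol\<close>

lemma unif_bigo_powerI:
  assumes "h1 > 0" "\<And>h \<tau>. 0 < h \<Longrightarrow> h \<le> h1 \<Longrightarrow> \<tau> \<in> {0..1} \<Longrightarrow> norm (f h \<tau>) \<le> C * h ^ k"
  shows "unif_bigo_power k f"
  unfolding unif_bigo_power_def
  using assms by (intro exI[of _ C] eventually_at_rightI[of 0 h1]) auto

text \<open>A nonnegative constant and an explicit \<open>0 < h\<close> are wanted whenever such
  bounds are multiplied or weakened.\<close>

lemma unif_bigo_powerE:
  assumes "unif_bigo_power k f"
  obtains C where "C \<ge> 0" "\<forall>\<^sub>F h in at_right 0. 0 < h \<and> (\<forall>\<tau>\<in>{0..1}. norm (f h \<tau>) \<le> C * h ^ k)"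
proof -
  obtain C where C: "\<forall>\<^sub>F h in at_right 0. \<forall>\<tau>\<in>{0..1}. norm (f h \<tau>) \<le> C * h ^ k"
    using assms by (auto simp: unif_bigo_power_def)
  have "\<forall>\<^sub>F h in at_right 0. 0 < h \<and> (\<forall>\<tau>\<in>{0..1}. norm (f h \<tau>) \<le> \<bar>C\<bar> * h ^ k)"
    using C eventually_at_right_less[of 0]
  proof eventually_elim
    case (elim h)
    then have "C * h ^ k \<le> \<bar>C\<bar> * h ^ k" by (intro mult_right_mono) auto
    with elim show ?case by (auto intro: order_trans[of _ "C * h ^ k"])
  qed
  then show ?thesis by (intro that[of "\<bar>C\<bar>"]) auto
qed

lemma unif_bigo_power_add:
  assumes "unif_bigo_power k f" "unif_bigo_power k g"
  shows "unif_bigo_power k (\<lambda>h \<tau>. f h \<tau> + g h \<tau>)"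
proof -
  obtain C where C: "\<forall>\<^sub>F h in at_right 0. 0 < h \<and> (\<forall>\<tau>\<in>{0..1}. norm (f h \<tau>) \<le> C * h ^ k)"
    using assms(1) by (rule unif_bigo_powerE)
  obtain D where D: "\<forall>\<^sub>F h in at_right 0. 0 < h \<and> (\<forall>\<tau>\<in>{0..1}. norm (g h \<tau>) \<le> D * h ^ k)"
    using assms(2) by (rule unif_bigo_powerE)
  have "\<forall>\<^sub>F h in at_right 0. \<forall>\<tau>\<in>{0..1}. norm (f h \<tau> + g h \<tau>) \<le> (C + D) * h ^ k"
    using C D by eventually_elim (auto simp: distrib_right intro!: norm_triangle_le add_mono)
  then show ?thesis unfolding unif_bigo_power_def by blast
qed

lemma unif_bigo_power_bound:
  assumes "unif_bigo_power k f"
    and "\<forall>\<^sub>F h in at_right 0. \<forall>\<tau>\<in>{0..1}. norm (g h \<tau>) \<le> L * norm (f h \<tau>)" "L \<ge> 0"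
  shows "unif_bigo_power k g"
proof -
  obtain C where C: "\<forall>\<^sub>F h in at_right 0. 0 < h \<and> (\<forall>\<tau>\<in>{0..1}. norm (f h \<tau>) \<le> C * h ^ k)"
    using assms(1) by (rule unif_bigo_powerE)
  have "\<forall>\<^sub>F h in at_right 0. \<forall>\<tau>\<in>{0..1}. norm (g h \<tau>) \<le> (L * C) * h ^ k"
    using C assms(2)
  proof eventually_elim
    case (elim h)
    show ?case
    proof
      fix \<tau> :: real assume "\<tau> \<in> {0..1}"
      then have "norm (g h \<tau>) \<le> L * norm (f h \<tau>)" "norm (f h \<tau>) \<le> C * h ^ k"
        using elim by auto
      then show "norm (g h \<tau>) \<le> (L * C) * h ^ k"
        using mult_left_mono[OF _ assms(3), of "norm (f h \<tau>)" "C * h ^ k"] by (simp add: mult.assoc)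
    qed
  qed
  then show ?thesis unfolding unif_bigo_power_def by blast
qed

lemma unif_bigo_power_mono:
  assumes "unif_bigo_power l f" "k \<le> l"
  shows "unif_bigo_power k f"
proof -
  obtain C where C: "C \<ge> 0" "\<forall>\<^sub>F h in at_right 0. 0 < h \<and> (\<forall>\<tau>\<in>{0..1}. norm (f h \<tau>) \<le> C * h ^ l)"
    using assms(1) by (rule unif_bigo_powerE)
  have "\<forall>\<^sub>F h::real in at_right 0. h < 1"
    by (rule eventually_at_rightI[of 0 1]) auto
  with C(2) have "\<forall>\<^sub>F h in at_right 0. \<forall>\<tau>\<in>{0..1}. norm (f h \<tau>) \<le> C * h ^ k"
  proof eventually_elim
    case (elim h)
    then have "C * h ^ l \<le> C * h ^ k"
      using assms(2) C(1) by (intro mult_left_mono power_decreasing) auto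
    with elim show ?case by (auto intro: order_trans[of _ "C * h ^ l"])
  qed
  then show ?thesis unfolding unif_bigo_power_def by blast
qed

text \<open>There are finitely many components, so their neighbourhoods of 0 can be intersected and
  their constants added.\<close>

lemma unif_bigo_power_vecI:
  fixes f :: "real \<Rightarrow> real \<Rightarrow> real^'d"
  assumes "\<And>j. unif_bigo_power k (\<lambda>h \<tau>. f h \<tau> $ j)"
  shows "unif_bigo_power k f"
proof -
  have "\<forall>j. \<exists>C. \<forall>\<^sub>F h in at_right 0. \<forall>\<tau>\<in>{0..1}. norm (f h \<tau> $ j) \<le> C * h ^ k"
    using assms by (simp add: unif_bigo_power_def)
  then obtain C where C: "\<forall>j. \<forall>\<^sub>F h in at_right 0. \<forall>\<tau>\<in>{0..1}. norm (f h \<tau> $ j) \<le> C j * h ^ k"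
    by (rule choice[THEN exE])
  have "\<forall>\<^sub>F h in at_right 0. \<forall>j. \<forall>\<tau>\<in>{0..1}. norm (f h \<tau> $ j) \<le> C j * h ^ k"
    by (rule eventually_all_finite) (rule C[rule_format])
  then have "\<forall>\<^sub>F h in at_right 0. \<forall>\<tau>\<in>{0..1}. norm (f h \<tau>) \<le> (\<Sum>j\<in>UNIV. C j) * h ^ k"
  proof eventually_elim
    case (elim h)
    show ?case
    proof
      fix \<tau> :: real assume \<tau>: "\<tau> \<in> {0..1}"
      have "norm (f h \<tau>) \<le> (\<Sum>j\<in>UNIV. \<bar>f h \<tau> $ j\<bar>)"
        by (rule norm_le_l1_cart)
      also have "\<dots> \<le> (\<Sum>j\<in>UNIV. C j * h ^ k)"
        using elim \<tau> by (intro sum_mono) simp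
      finally show "norm (f h \<tau>) \<le> (\<Sum>j\<in>UNIV. C j) * h ^ k"
        by (simp add: sum_distrib_right)
    qed
  qed
  then show ?thesis unfolding unif_bigo_power_def by blast
qed

text \<open>The derivatives in the stepsize are the formal ones. At \<open>h = 0\<close> the n-th is
  \<open>fact n\<close> times the n-th coefficient, whose degree the grading controls, and the
  remainder is that of a polynomial.\<close>

lemma regular_evv:
  fixes W :: "'d::finite \<Rightarrow> real poly poly"
  assumes "\<And>j. graded 0 (W j)"
  shows "regular r (evv W)"
proof -
  define D where "D n = evv (\<lambda>j. (pderiv ^^ n) (W j))" for n
  have D0: "(D n 0 \<tau> /\<^sub>R fact n) $ j = poly (coeff (W j) n) \<tau>" for n \<tau> j
  proof -
    have "coeff ((pderiv ^^ n) (W j)) 0 = of_nat (fact n) * coeff (W j) n"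
      using coeff_higher_pderiv[of n "W j" 0] by (simp add: pochhammer_fact[symmetric] of_nat_fact)
    moreover have "poly (fact n) \<tau> = fact n"
      by (metis of_nat_fact poly_of_nat)
    ultimately show ?thesis by (simp add: D_def ev_at_0)
  qed
  show ?thesis
    unfolding regular_def
  proof (intro exI[of _ "1::real"] exI[of _ D] conjI ballI allI impI)
    show "continuous_on {0..1} (evv W h)" for h by (rule continuous_on_evv)
    show "((\<lambda>s. D n s \<tau>) has_vector_derivative D (Suc n) h \<tau>) (at h within {0..1})" for n h \<tau>
      unfolding D_def funpow.simps o_def by (rule evv_deriv_h)
    show "\<exists>p. degree p \<le> n \<and> (\<forall>\<tau>\<in>{0..1}. (D n 0 \<tau> /\<^sub>R fact n) $ j = poly p \<tau>)" for n j
      using assms D0 by (intro exI[of _ "coeff (W j) n"]) (auto simp: graded_def)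
    show "unif_bigo_power r (\<lambda>h \<tau>. evv W h \<tau> - (\<Sum>n<r. h ^ n *\<^sub>R (D n 0 \<tau> /\<^sub>R fact n)))"
    proof (rule unif_bigo_power_vecI)
      fix j
      obtain C where "\<forall>h\<in>{0..1}. \<forall>\<tau>\<in>{0..1}.
          \<bar>ev (W j) h \<tau> - (\<Sum>n<r. h ^ n * poly (coeff (W j) n) \<tau>)\<bar> \<le> C * h ^ r"
        using ev_taylor_remainder by blast
      then show "unif_bigo_power r
          (\<lambda>h \<tau>. (evv W h \<tau> - (\<Sum>n<r. h ^ n *\<^sub>R (D n 0 \<tau> /\<^sub>R fact n))) $ j)"
        unfolding vector_minus_component sum_component evv_nth vector_scaleR_component[of "_ ^ _"] D0
        by (intro unif_bigo_powerI[of 1 _ C]) auto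
    qed
  qed (simp_all add: D_def)
qed

section \<open>Composition with smooth functions\<close>

lemma Ck_on_imp_continuous_on: "Ck_on k S f \<Longrightarrow> continuous_on S f"
  by (cases k) (auto simp: continuous_on_eq_continuous_within intro: has_derivative_continuous)

lemma linear_axis_expansion:
  fixes L :: "real^'d \<Rightarrow> real"
  assumes "linear L"
  shows "L v = (\<Sum>j\<in>UNIV. v $ j * L (axis j 1))"
proof -
  have "L v = L (\<Sum>j\<in>UNIV. v $ j *\<^sub>R axis j 1)"
    using basis_expansion[of v] by (simp add: scalar_mult_eq_scaleR)
  then show ?thesis
    using assms by (simp add: linear_sum linear_scale)
qed

text \<open>The operator norm of the derivative is at most the sum of the absolute partial
  derivatives. That sum is continuous, hence bounded on the compact ball, and convexity of the ball
  permits the mean value inequality.\<close>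

lemma Ck_on_lipschitz_cball:
  fixes G :: "real^'d \<Rightarrow> real"
  assumes "Ck_on (Suc k) UNIV G"
  shows "\<exists>L\<ge>0. \<forall>x\<in>cball 0 B. \<forall>y\<in>cball 0 B. \<bar>G x - G y\<bar> \<le> L * norm (x - y)"
proof -
  obtain G' where G': "\<And>x. (G has_derivative G' x) (at x)"
    and C: "\<And>v. Ck_on k UNIV (\<lambda>x. G' x v)"
    using assms by auto
  have lin: "linear (G' x)" for x
    using G' has_derivative_linear by blast
  let ?N = "\<lambda>x. \<Sum>j\<in>UNIV. \<bar>G' x (axis j 1)\<bar>"
  have "continuous_on (cball 0 B) ?N"
    by (intro continuous_intros continuous_on_subset[OF Ck_on_imp_continuous_on[OF C]]) auto
  then have "bounded (?N ` cball 0 B)"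
    by (intro compact_imp_bounded compact_continuous_image compact_cball)
  then obtain L where L: "L > 0" "\<forall>y\<in>?N ` cball 0 B. norm y \<le> L"
    using bounded_pos by blast
  have "onorm (G' x) \<le> L" if "x \<in> cball 0 B" for x
  proof (rule onorm_le)
    fix v
    have "norm (G' x v) \<le> (\<Sum>j\<in>UNIV. \<bar>v $ j * G' x (axis j 1)\<bar>)"
      unfolding linear_axis_expansion[OF lin, of x v] real_norm_def by (rule sum_abs)
    also have "\<dots> \<le> (\<Sum>j\<in>UNIV. norm v * \<bar>G' x (axis j 1)\<bar>)"
      unfolding abs_mult by (intro sum_mono mult_right_mono component_le_norm_cart) auto
    also have "\<dots> = ?N x * norm v"
      by (simp add: sum_distrib_left mult.commute)
    also have "\<dots> \<le> L * norm v"
    proof (rule mult_right_mono)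
      have "norm (?N x) \<le> L" using L(2) that by blast
      then show "?N x \<le> L" unfolding real_norm_def by (rule order_trans[OF abs_ge_self])
    qed simp
    finally show "norm (G' x v) \<le> L * norm v" .
  qed
  then have "norm (G x - G y) \<le> L * norm (x - y)" if "x \<in> cball 0 B" "y \<in> cball 0 B" for x y
    using that by (intro differentiable_bound[of "cball 0 B" G G']) (auto intro: has_derivative_at_withinI[OF G'])
  then show ?thesis using L(1) by (intro exI[of _ L]) auto
qed

text \<open>The stepsize derivative of \<open>G (evv W h \<tau>)\<close> is expanded by the induction hypothesis for the
  partial derivatives of \<open>G\<close>; integrating in \<open>h\<close> gains one order and restores the grading.\<close>

lemma graded_compose:
  fixes G :: "real^'d \<Rightarrow> real"
  assumes "Ck_on k UNIV G" and W: "\<And>j. graded 0 (W j)"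
  shows "\<exists>F. graded 0 F \<and> (\<exists>C. \<forall>h\<in>{0..1}. \<forall>\<tau>\<in>{0..1}. \<bar>G (evv W h \<tau>) - ev F h \<tau>\<bar> \<le> C * h ^ k)"
  using assms(1)
proof (induction k arbitrary: G)
  case 0
  have cont: "continuous_on ({0..1} \<times> {0..1}) (\<lambda>x. G (evv W (fst x) (snd x)))"
  proof (rule continuous_on_compose2[OF Ck_on_imp_continuous_on[OF 0] _ subset_UNIV])
    show "continuous_on ({0..1} \<times> {0..1}) (\<lambda>x. evv W (fst x) (snd x))"
      unfolding evv_def by (rule continuous_on_vec_lambda) (rule continuous_on_ev)
  qed
  have "compact ((\<lambda>x. G (evv W (fst x) (snd x))) ` ({0..1} \<times> {0..1}))"
    by (intro compact_continuous_image cont compact_Times) auto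
  then obtain C where C: "\<forall>y\<in>(\<lambda>x. G (evv W (fst x) (snd x))) ` ({0..1} \<times> {0..1}). norm y \<le> C"
    using compact_imp_bounded bounded_iff by blast
  \<comment> \<open>At order zero the zero polynomial suffices, because the claim is only
    boundedness on a compact square.\<close>
  show ?case using C by (intro exI[of _ 0] conjI graded_0 exI[of _ C]) auto
next
  case (Suc k)
  obtain G' where G': "\<And>x. (G has_derivative G' x) (at x)"
    and C: "\<And>v. Ck_on k UNIV (\<lambda>x. G' x v)"
    using Suc.prems by auto
  have lin: "linear (G' x)" for x
    using G' has_derivative_linear by blast
  have "\<forall>j. \<exists>F C. graded 0 F \<and>
      (\<forall>h\<in>{0..1}. \<forall>\<tau>\<in>{0..1}. \<bar>G' (evv W h \<tau>) (axis j 1) - ev F h \<tau>\<bar> \<le> C * h ^ k)"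
    using Suc.IH[OF C] by blast
  then obtain F where "\<forall>j. \<exists>C. graded 0 (F j) \<and>
      (\<forall>h\<in>{0..1}. \<forall>\<tau>\<in>{0..1}. \<bar>G' (evv W h \<tau>) (axis j 1) - ev (F j) h \<tau>\<bar> \<le> C * h ^ k)"
    by (rule choice[THEN exE])
  then obtain K where FK: "\<forall>j. graded 0 (F j) \<and>
      (\<forall>h\<in>{0..1}. \<forall>\<tau>\<in>{0..1}. \<bar>G' (evv W h \<tau>) (axis j 1) - ev (F j) h \<tau>\<bar> \<le> K j * h ^ k)"
    by (rule choice[THEN exE])
  have "\<forall>j. \<exists>B. 0 \<le> B \<and> (\<forall>h\<in>{0..1}. \<forall>\<tau>\<in>{0..1}. \<bar>ev (pderiv (W j)) h \<tau>\<bar> \<le> B)"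
    using ev_bounded by blast
  then obtain B where B: "\<forall>j. 0 \<le> B j \<and> (\<forall>h\<in>{0..1}. \<forall>\<tau>\<in>{0..1}. \<bar>ev (pderiv (W j)) h \<tau>\<bar> \<le> B j)"
    by (rule choice[THEN exE])
  \<comment> \<open>This is the chain rule with each partial derivative replaced by its expansion;
    the factor \<open>pderiv (W j)\<close> brings in a slack of one.\<close>
  define D where "D = (\<Sum>j\<in>UNIV. F j * pderiv (W j))"
  have "graded (0 + Suc 0) D"
    unfolding D_def using FK W by (intro graded_sum graded_mult graded_pderiv) auto
  then have D: "degree (coeff D n) \<le> Suc n" for n
    by (simp add: graded_def)
  obtain E where E: "pderiv E = D" "coeff E 0 = [:G (evv W 0 0):]"
    and degE: "\<And>n. degree (coeff E (Suc n)) \<le> degree (coeff D n)"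
    using antiderivative_h[of D "[:G (evv W 0 0):]"] by blast
  have gE: "graded 0 E"
    unfolding graded_def
  proof
    show "degree (coeff E n) \<le> n + 0" for n
      using E(2) order_trans[OF degE D] by (cases n) auto
  qed
  let ?C = "\<Sum>j\<in>UNIV. \<bar>K j\<bar> * B j"
  have "\<bar>G (evv W h \<tau>) - ev E h \<tau>\<bar> \<le> ?C * h ^ Suc k" if h: "h \<in> {0..1}" and \<tau>: "\<tau> \<in> {0..1}" for h \<tau>
  proof -
    let ?f = "\<lambda>s. G (evv W s \<tau>) - ev E s \<tau>"
    let ?d = "\<lambda>s. \<Sum>j\<in>UNIV. (G' (evv W s \<tau>) (axis j 1) - ev (F j) s \<tau>) * ev (pderiv (W j)) s \<tau>"
    have deriv: "(?f has_real_derivative ?d s) (at s within {0..h})" for s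
    proof -
      have "((\<lambda>s. G (evv W s \<tau>)) has_vector_derivative
          G' (evv W s \<tau>) (evv (\<lambda>j. pderiv (W j)) s \<tau>)) (at s within {0..h})"
        using vector_derivative_diff_chain_within[OF evv_deriv_h has_derivative_at_withinI[OF G']]
        unfolding o_def .
      then have "((\<lambda>s. G (evv W s \<tau>)) has_real_derivative
          (\<Sum>j\<in>UNIV. ev (pderiv (W j)) s \<tau> * G' (evv W s \<tau>) (axis j 1))) (at s within {0..h})"
        unfolding has_real_derivative_iff_has_vector_derivative evv_nth
          linear_axis_expansion[OF lin, of "evv W s \<tau>" "evv (\<lambda>j. pderiv (W j)) s \<tau>"] .
      from DERIV_diff[OF this ev_deriv_h[of E \<tau>]] show ?thesis
        unfolding E(1) D_def ev_sum ev_mult sum_subtractf[symmetric]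
        by (simp only: left_diff_distrib mult.commute[of "ev (pderiv _) _ _"])
    qed
    have bound: "norm (?d s) \<le> ?C * h ^ k" if s: "s \<in> {0..h}" for s
    proof -
      have s': "s \<in> {0..1}" using s h by auto
      have "norm (?d s) \<le> (\<Sum>j\<in>UNIV. \<bar>(G' (evv W s \<tau>) (axis j 1) - ev (F j) s \<tau>) * ev (pderiv (W j)) s \<tau>\<bar>)"
        unfolding real_norm_def by (rule sum_abs)
      also have "\<dots> \<le> (\<Sum>j\<in>UNIV. \<bar>K j\<bar> * h ^ k * B j)"
      proof (rule sum_mono)
        fix j
        have "\<bar>G' (evv W s \<tau>) (axis j 1) - ev (F j) s \<tau>\<bar> \<le> K j * s ^ k"
          using FK s' \<tau> by blast
        \<comment> \<open>The sign of \<open>K j\<close> is unknown, hence the absolute value;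
          \<open>s \<le> h\<close> makes the bound uniform on the segment.\<close>
        also have "\<dots> \<le> \<bar>K j\<bar> * h ^ k"
          using s by (intro mult_mono power_mono) auto
        finally show "\<bar>(G' (evv W s \<tau>) (axis j 1) - ev (F j) s \<tau>) * ev (pderiv (W j)) s \<tau>\<bar>
            \<le> \<bar>K j\<bar> * h ^ k * B j"
          unfolding abs_mult using B s' \<tau> h by (intro mult_mono) auto
      qed
      also have "\<dots> = ?C * h ^ k"
        unfolding sum_distrib_right by (simp only: mult.assoc mult.commute[of "h ^ k"])
      finally show ?thesis .
    qed
    have "norm (?f h - ?f 0) \<le> ?C * h ^ k * norm (h - 0)"
      using h by (intro field_differentiable_bound[where S = "{0..h}" and f' = ?d] deriv bound) auto
    moreover have "?f 0 = 0"
    proof -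
      \<comment> \<open>The grading makes the lowest coefficient constant in \<tau>. Therefore the
        value at \<tau> = 0, chosen as the lowest coefficient of \<open>E\<close>, is correct for
        every \<tau>.\<close>
      have "poly (coeff (W j) 0) \<tau> = poly (coeff (W j) 0) 0" for j
      proof -
        have "degree (coeff (W j) 0) = 0" 
          using W[of j, unfolded graded_def, rule_format, of 0] by simp
        then show ?thesis by (auto elim: degree_eq_zeroE)
      qed
      then have "evv W 0 \<tau> = evv W 0 0" by (simp add: vec_eq_iff ev_at_0)
      then show ?thesis by (simp add: ev_at_0 E(2))
    qed
    ultimately show ?thesis using h by (simp add: mult_ac)
  qed
  with gE show ?case by blast
qed

lemma graded_compose_vec:
  fixes g :: "real^'d \<Rightarrow> real^'d"
  assumes "\<And>i. Ck_on k UNIV (\<lambda>x. g x $ i)" and "\<And>j. graded 0 (W j)"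
  shows "\<exists>F. (\<forall>j. graded 0 (F j)) \<and> unif_bigo_power k (\<lambda>h \<tau>. g (evv W h \<tau>) - evv F h \<tau>)"
proof -
  have "\<forall>i. \<exists>F. graded 0 F \<and>
      (\<exists>C. \<forall>h\<in>{0..1}. \<forall>\<tau>\<in>{0..1}. \<bar>g (evv W h \<tau>) $ i - ev F h \<tau>\<bar> \<le> C * h ^ k)"
    by (intro allI graded_compose assms)
  then obtain F where F: "\<forall>i. graded 0 (F i) \<and>
      (\<exists>C. \<forall>h\<in>{0..1}. \<forall>\<tau>\<in>{0..1}. \<bar>g (evv W h \<tau>) $ i - ev (F i) h \<tau>\<bar> \<le> C * h ^ k)"
    by (rule choice[THEN exE])
  have "unif_bigo_power k (\<lambda>h \<tau>. g (evv W h \<tau>) - evv F h \<tau>)"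
  proof (rule unif_bigo_power_vecI)
    fix i
    obtain C where "\<forall>h\<in>{0..1}. \<forall>\<tau>\<in>{0..1}. \<bar>g (evv W h \<tau>) $ i - ev (F i) h \<tau>\<bar> \<le> C * h ^ k"
      using F by blast
    then show "unif_bigo_power k (\<lambda>h \<tau>. (g (evv W h \<tau>) - evv F h \<tau>) $ i)"
      by (intro unif_bigo_powerI[of 1 _ C]) auto
  qed
  with F show ?thesis by blast
qed

lemma lipschitz_cball_vec:
  fixes g :: "real^'d \<Rightarrow> real^'d"
  assumes "\<And>i. Ck_on (Suc k) UNIV (\<lambda>x. g x $ i)"
  shows "\<exists>L\<ge>0. \<forall>x\<in>cball 0 B. \<forall>y\<in>cball 0 B. norm (g x - g y) \<le> L * norm (x - y)"
proof -
  have "\<forall>i. \<exists>L. 0 \<le> L \<and> (\<forall>x\<in>cball 0 B. \<forall>y\<in>cball 0 B. \<bar>g x $ i - g y $ i\<bar> \<le> L * norm (x - y))"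
    using Ck_on_lipschitz_cball[OF assms] by blast
  then obtain L where L: "\<forall>i. 0 \<le> L i \<and> (\<forall>x\<in>cball 0 B. \<forall>y\<in>cball 0 B. \<bar>g x $ i - g y $ i\<bar> \<le> L i * norm (x - y))"
    by (rule choice[THEN exE])
  have "norm (g x - g y) \<le> (\<Sum>i\<in>UNIV. L i) * norm (x - y)" if "x \<in> cball 0 B" "y \<in> cball 0 B" for x y
  proof -
    have "norm (g x - g y) \<le> (\<Sum>i\<in>UNIV. \<bar>(g x - g y) $ i\<bar>)" by (rule norm_le_l1_cart)
    also have "\<dots> \<le> (\<Sum>i\<in>UNIV. L i * norm (x - y))"
      using L that by (intro sum_mono) simp
    finally show ?thesis by (simp add: sum_distrib_right)
  qed
  moreover have "0 \<le> (\<Sum>i\<in>UNIV. L i)"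
    using L by (intro sum_nonneg) blast
  ultimately show ?thesis by blast
qed

section \<open>Expansion of the numerical solution\<close>

lemma (in orthonormal_01) proj_add:
  fixes f g :: "real \<Rightarrow> real^'d"
  assumes f: "f absolutely_integrable_on {0..1}" and g: "g absolutely_integrable_on {0..1}"
  shows "proj r \<psi> (\<lambda>\<tau>. f \<tau> + g \<tau>) \<tau> = proj r \<psi> f \<tau> + proj r \<psi> g \<tau>"
proof -
  have "coef i (\<lambda>\<tau>. f \<tau> + g \<tau>) = coef i f + coef i g" if "i < r" for i
    using that unfolding coef_def scaleR_add_right by (intro integral_add coef_integrable f g)
  then show ?thesis
    by (simp add: proj_eq f g set_integral_add(1) scaleR_add_right sum.distrib)
qed

lemma norm_add_power2_le: "(norm (a + b))\<^sup>2 \<le> 2 * (norm a)\<^sup>2 + 2 * (norm b)\<^sup>2"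
  for a b :: "'a::real_normed_vector"
proof -
  have "(norm (a + b))\<^sup>2 \<le> (norm a + norm b)\<^sup>2"
    by (intro power_mono norm_triangle_ineq) simp
  also have "\<dots> \<le> 2 * (norm a)\<^sup>2 + 2 * (norm b)\<^sup>2"
    using sum_squares_bound[of "norm a" "norm b"] by (simp add: power2_sum)
  finally show ?thesis .
qed

lemma evv_bounded:
  fixes W :: "'d::finite \<Rightarrow> real poly poly"
  shows "\<exists>C. \<forall>h\<in>{0..1}. \<forall>\<tau>\<in>{0..1}. norm (evv W h \<tau>) \<le> C"
proof -
  have "\<forall>j. \<exists>B. \<forall>h\<in>{0..1}. \<forall>\<tau>\<in>{0..1}. \<bar>ev (W j) h \<tau>\<bar> \<le> B"
    using ev_bounded by blast
  then obtain B where B: "\<forall>j. \<forall>h\<in>{0..1}. \<forall>\<tau>\<in>{0..1}. \<bar>ev (W j) h \<tau>\<bar> \<le> B j"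
    by (rule choice[THEN exE])
  have "norm (evv W h \<tau>) \<le> (\<Sum>j\<in>UNIV. B j)" if "h \<in> {0..1}" "\<tau> \<in> {0..1}" for h \<tau>
    using B that by (intro order_trans[OF norm_le_l1_cart] sum_mono) simp
  then show ?thesis by blast
qed

definition matmul :: "real^'d^'d \<Rightarrow> ('d \<Rightarrow> real poly poly) \<Rightarrow> 'd \<Rightarrow> real poly poly" where
  "matmul A W j = (\<Sum>l\<in>UNIV. [:[:A $ j $ l:]:] * W l)"

lemma evv_matmul: "evv (matmul A W) h \<tau> = A *v evv W h \<tau>"
  unfolding vec_eq_iff evv_nth matmul_def ev_sum ev_mult by (simp add: matrix_vector_mult_def)

lemma graded_matmul:
  assumes "\<And>j. graded 0 (W j)"
  shows "graded 0 (matmul A W j)"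
  unfolding matmul_def
proof (rule graded_sum)
  fix l
  have "graded 0 [:[:A $ j $ l:]:]" by (simp add: graded_def coeff_pCons split: nat.split)
  from graded_mult[OF this assms] show "graded 0 ([:[:A $ j $ l:]:] * W l)" by simp
qed

lemma evv_add: "evv (\<lambda>j. F j + G j) h \<tau> = evv F h \<tau> + evv G h \<tau>"
  by (simp add: vec_eq_iff ev_add)

text \<open>The asymptotic analysis starts from the differential equation, the initial value and one
  bound \<open>B\<close> valid for all stepsizes. The bound supplies the expansion of order zero and
  a fixed ball on which \<open>g\<close> is Lipschitz.\<close>

locale ECr_family =
  fixes r :: nat and \<psi> :: "real \<Rightarrow> nat \<Rightarrow> real \<Rightarrow> real"
    and A :: "real^'d^'d" and g :: "real^'d \<Rightarrow> real^'d" and y0 :: "real^'d"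
    and u :: "real \<Rightarrow> real \<Rightarrow> real^'d" and h0 B :: real
  assumes h0: "0 < h0" and r: "1 \<le> r"
    and system: "\<And>h. 0 < h \<Longrightarrow> h \<le> h0 \<Longrightarrow> orthonormal_01 r (\<psi> h)"
    and proj_regular: "\<And>w :: real \<Rightarrow> real \<Rightarrow> real^'d. regular r w \<Longrightarrow>
      unif_bigo_power r (\<lambda>h \<tau>. proj r (\<psi> h) (w h) \<tau> - w h \<tau>)"
    and u_deriv: "\<And>h \<tau>. 0 < h \<Longrightarrow> h \<le> h0 \<Longrightarrow> \<tau> \<in> {0..1} \<Longrightarrow> (u h has_vector_derivative
      h *\<^sub>R (A *v u h \<tau> + proj r (\<psi> h) (\<lambda>\<sigma>. g (u h \<sigma>)) \<tau>)) (at \<tau> within {0..1})"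
    and u_0: "\<And>h. 0 < h \<Longrightarrow> h \<le> h0 \<Longrightarrow> u h 0 = y0"
    and u_bounded: "\<And>h \<tau>. 0 < h \<Longrightarrow> h \<le> h0 \<Longrightarrow> \<tau> \<in> {0..1} \<Longrightarrow> norm (u h \<tau>) \<le> B"
    and g_smooth: "\<And>i. Ck_on r UNIV (\<lambda>x. g x $ i)"
begin

lemma eventually_stepsize: "\<forall>\<^sub>F h in at_right 0. 0 < h \<and> h \<le> h0 \<and> h \<le> 1"
  using h0 by (intro eventually_at_rightI[of 0 "min h0 1"]) auto

lemma continuous_on_u: "0 < h \<Longrightarrow> h \<le> h0 \<Longrightarrow> continuous_on {0..1} (u h)"
  using has_vector_derivative_continuous[OF u_deriv] by (simp add: continuous_on_eq_continuous_within)

lemma continuous_on_g: "continuous_on S g"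
proof -
  have "continuous_on S (\<lambda>x. \<chi> i. g x $ i)"
    by (intro continuous_on_vec_lambda continuous_on_subset[OF Ck_on_imp_continuous_on[OF g_smooth]]) auto
  then show ?thesis by simp
qed

lemma continuous_on_gu: "0 < h \<Longrightarrow> h \<le> h0 \<Longrightarrow> continuous_on {0..1} (\<lambda>\<tau>. g (u h \<tau>))"
  by (rule continuous_on_compose2[OF continuous_on_g continuous_on_u subset_UNIV])

text \<open>Nothing is known about the supremum norm of the projections; in the mean square they are
  contractions, so the hypothesis on regular functions transfers to functions with an expansion.\<close>

lemma residual_mean_square:
  fixes f :: "real \<Rightarrow> real \<Rightarrow> real^'d"
  assumes f: "\<And>h. 0 < h \<Longrightarrow> h \<le> h0 \<Longrightarrow> continuous_on {0..1} (f h)"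
    and W: "\<And>j. graded 0 (W j)"
    and fW: "unif_bigo_power k (\<lambda>h \<tau>. f h \<tau> - evv W h \<tau>)" and k: "k \<le> r"
  shows "\<exists>C\<ge>0. \<forall>\<^sub>F h in at_right 0.
    integral {0..1} (\<lambda>\<tau>. (norm (f h \<tau> - proj r (\<psi> h) (f h) \<tau>))\<^sup>2) \<le> C * (h ^ k)\<^sup>2"
proof -
  obtain C where C: "0 \<le> C" "\<forall>\<^sub>F h in at_right 0. 0 < h \<and> (\<forall>\<tau>\<in>{0..1}. norm (f h \<tau> - evv W h \<tau>) \<le> C * h ^ k)"
    using fW by (rule unif_bigo_powerE)
  have "unif_bigo_power k (\<lambda>h \<tau>. proj r (\<psi> h) (evv W h) \<tau> - evv W h \<tau>)"
    by (intro unif_bigo_power_mono[OF proj_regular[OF regular_evv[OF W]] k])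
  then obtain D where D: "0 \<le> D" "\<forall>\<^sub>F h in at_right 0. 0 < h \<and>
      (\<forall>\<tau>\<in>{0..1}. norm (proj r (\<psi> h) (evv W h) \<tau> - evv W h \<tau>) \<le> D * h ^ k)"
    by (rule unif_bigo_powerE)
  have "\<forall>\<^sub>F h in at_right 0.
      integral {0..1} (\<lambda>\<tau>. (norm (f h \<tau> - proj r (\<psi> h) (f h) \<tau>))\<^sup>2) \<le> (2 * C\<^sup>2 + 2 * D\<^sup>2) * (h ^ k)\<^sup>2"
    using C(2) D(2) eventually_stepsize
  proof eventually_elim
    case (elim h)
    interpret orthonormal_01 r "\<psi> h" using elim by (intro system) auto
    let ?w = "evv W h" and ?d = "\<lambda>\<tau>. f h \<tau> - evv W h \<tau>"
    have wc: "continuous_on {0..1} ?w" by (rule continuous_on_evv)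
    have dc: "continuous_on {0..1} ?d" using elim by (intro continuous_intros f wc) auto
    note ai = absolutely_integrable_continuous_real
    note pc = continuous_on_proj[OF ai]
    \<comment> \<open>The residual of the expansion \<open>?w\<close> is small pointwise by the
      hypothesis on regular functions, that of the remainder \<open>?d\<close> is small in the mean
      square by contraction. The factors 2 come from squaring a sum of two terms.\<close>
    have eq: "f h \<tau> - proj r (\<psi> h) (f h) \<tau>
        = (?d \<tau> - proj r (\<psi> h) ?d \<tau>) + (?w \<tau> - proj r (\<psi> h) ?w \<tau>)" for \<tau>
      using proj_add[OF ai[OF dc] ai[OF wc], of \<tau>] by (simp add: algebra_simps)
    have "integral {0..1} (\<lambda>\<tau>. (norm (f h \<tau> - proj r (\<psi> h) (f h) \<tau>))\<^sup>2)
        \<le> integral {0..1} (\<lambda>\<tau>. 2 * (norm (?d \<tau> - proj r (\<psi> h) ?d \<tau>))\<^sup>2 + 2 * (D * h ^ k)\<^sup>2)"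
    proof (rule integral_le)
      show "(\<lambda>\<tau>. (norm (f h \<tau> - proj r (\<psi> h) (f h) \<tau>))\<^sup>2) integrable_on {0..1}"
        unfolding eq by (intro integrable_continuous_real continuous_intros pc dc wc)
      show "(\<lambda>\<tau>. 2 * (norm (?d \<tau> - proj r (\<psi> h) ?d \<tau>))\<^sup>2 + 2 * (D * h ^ k)\<^sup>2) integrable_on {0..1}"
        by (intro integrable_continuous_real continuous_intros pc dc)
      fix \<tau> :: real assume "\<tau> \<in> {0..1}"
      then have "norm (?w \<tau> - proj r (\<psi> h) ?w \<tau>) \<le> D * h ^ k"
        using elim by (simp add: norm_minus_commute)
      then have "(norm (?w \<tau> - proj r (\<psi> h) ?w \<tau>))\<^sup>2 \<le> (D * h ^ k)\<^sup>2"
        by (intro power_mono) auto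
      then show "(norm (f h \<tau> - proj r (\<psi> h) (f h) \<tau>))\<^sup>2
          \<le> 2 * (norm (?d \<tau> - proj r (\<psi> h) ?d \<tau>))\<^sup>2 + 2 * (D * h ^ k)\<^sup>2"
        unfolding eq
        using norm_add_power2_le[of "?d \<tau> - proj r (\<psi> h) ?d \<tau>" "?w \<tau> - proj r (\<psi> h) ?w \<tau>"] by linarith
    qed
    also have "\<dots> = 2 * integral {0..1} (\<lambda>\<tau>. (norm (?d \<tau> - proj r (\<psi> h) ?d \<tau>))\<^sup>2) + 2 * (D * h ^ k)\<^sup>2"
      by (subst integral_add) (auto intro!: integrable_continuous_real continuous_intros pc dc)
    also have "integral {0..1} (\<lambda>\<tau>. (norm (?d \<tau> - proj r (\<psi> h) ?d \<tau>))\<^sup>2)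
        \<le> integral {0..1} (\<lambda>\<tau>. (norm (?d \<tau>))\<^sup>2)"
      by (rule residual_norm_le[OF dc])
    also have "\<dots> \<le> integral {0..1} (\<lambda>\<tau>::real. (C * h ^ k)\<^sup>2)"
      using elim by (intro integral_le integrable_continuous_real continuous_intros dc power_mono) auto
    finally show ?case by (simp add: power_mult_distrib algebra_simps)
  qed
  then show ?thesis by (intro exI[of _ "2 * C\<^sup>2 + 2 * D\<^sup>2"]) auto
qed

text \<open>First \<open>u\<close> is replaced by its expansion inside \<open>g\<close>, at the cost
  of a Lipschitz constant; then the composition of \<open>g\<close> with a graded polynomial is
  expanded.\<close>

lemma gu_expansion:
  assumes W: "\<And>j. graded 0 (W j)" and uW: "unif_bigo_power k (\<lambda>h \<tau>. u h \<tau> - evv W h \<tau>)" and k: "k \<le> r"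
  shows "\<exists>F. (\<forall>j. graded 0 (F j)) \<and> unif_bigo_power k (\<lambda>h \<tau>. g (u h \<tau>) - evv F h \<tau>)"
proof -
  obtain F where F: "\<forall>j. graded 0 (F j)" "unif_bigo_power r (\<lambda>h \<tau>. g (evv W h \<tau>) - evv F h \<tau>)"
    using graded_compose_vec[where W = W, OF g_smooth W] by blast
  obtain K where K: "\<forall>h\<in>{0..1}. \<forall>\<tau>\<in>{0..1}. norm (evv W h \<tau>) \<le> K"
    using evv_bounded by blast
  \<comment> \<open>Since \<open>r\<close> is positive, \<open>g\<close> is continuously
    differentiable and thus Lipschitz on the ball of radius \<open>max B K\<close>, which contains
    both \<open>u\<close> and its expansion.\<close>
  have "Ck_on (Suc (r - 1)) UNIV (\<lambda>x. g x $ i)" for i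
    using g_smooth r by simp
  then obtain L where L: "0 \<le> L"
    "\<forall>x\<in>cball 0 (max B K). \<forall>y\<in>cball 0 (max B K). norm (g x - g y) \<le> L * norm (x - y)"
    using lipschitz_cball_vec by blast
  have "unif_bigo_power k (\<lambda>h \<tau>. g (u h \<tau>) - g (evv W h \<tau>))"
  proof (rule unif_bigo_power_bound[OF uW _ L(1)])
    show "\<forall>\<^sub>F h in at_right 0. \<forall>\<tau>\<in>{0..1}. norm (g (u h \<tau>) - g (evv W h \<tau>)) \<le> L * norm (u h \<tau> - evv W h \<tau>)"
      using eventually_stepsize
    proof eventually_elim
      case (elim h)
      have "u h \<tau> \<in> cball 0 (max B K)" "evv W h \<tau> \<in> cball 0 (max B K)" if "\<tau> \<in> {0..1}" for \<tau>
        using that elim u_bounded[of h \<tau>] K by (auto simp: le_max_iff_disj)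
      with L(2) show ?case by blast
    qed
  qed
  from unif_bigo_power_add[OF this unif_bigo_power_mono[OF F(2) k]]
  have "unif_bigo_power k (\<lambda>h \<tau>. g (u h \<tau>) - evv F h \<tau>)" by simp
  with F(1) show ?thesis by blast
qed

text \<open>A Picard step: \<open>W'\<close> is the initial value plus \<open>h\<close> times the
  integral of the expansion of \<open>A *v u + g u\<close>. The factor \<open>h\<close> gains the
  order, and only the integral of the projection error enters, so its mean-square bound
  suffices.\<close>

lemma u_expansion_step:
  assumes W: "\<And>j. graded 0 (W j)" and uW: "unif_bigo_power k (\<lambda>h \<tau>. u h \<tau> - evv W h \<tau>)" and k: "k \<le> r"
  shows "\<exists>W'. (\<forall>j. graded 0 (W' j)) \<and> unif_bigo_power (Suc k) (\<lambda>h \<tau>. u h \<tau> - evv W' h \<tau>)"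
proof -
  obtain F where F: "\<And>j. graded 0 (F j)" and gF: "unif_bigo_power k (\<lambda>h \<tau>. g (u h \<tau>) - evv F h \<tau>)"
    using gu_expansion[OF assms] by blast
  define N where "N = (\<lambda>j. matmul A W j + F j)"
  define W' where "W' = (\<lambda>j. pCons [:y0 $ j:] (map_poly pint (N j)))"
  have gradedW': "graded 0 (W' j)" for j
    unfolding W'_def N_def by (intro graded_pCons_map_pint graded_add graded_matmul W F)
  have evN: "evv N h \<tau> = A *v evv W h \<tau> + evv F h \<tau>" for h \<tau>
    unfolding N_def evv_add evv_matmul ..
  have W'_0: "evv W' h 0 = y0" for h
    by (simp add: vec_eq_iff W'_def ev_map_pint_0)
  have W'_deriv: "(evv W' h has_vector_derivative h *\<^sub>R evv N h \<tau>) (at \<tau> within S)" for h \<tau> S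
  proof (rule has_vector_derivative_vecI)
    show "((\<lambda>t. evv W' h t $ j) has_vector_derivative (h *\<^sub>R evv N h \<tau>) $ j) (at \<tau> within S)" for j
      unfolding has_real_derivative_iff_has_vector_derivative[symmetric]
      by (auto simp: W'_def intro!: derivative_eq_intros ev_map_pint_deriv)
  qed
  obtain K where K: "K > 0" "\<And>x. norm (A *v x) \<le> norm x * K"
    using bounded_linear.pos_bounded[OF matrix_vector_mul_bounded_linear] by blast
  obtain C1 where C1: "0 \<le> C1" "\<forall>\<^sub>F h in at_right 0. 0 < h \<and> (\<forall>\<tau>\<in>{0..1}. norm (u h \<tau> - evv W h \<tau>) \<le> C1 * h ^ k)"
    using uW by (rule unif_bigo_powerE)
  obtain C2 where C2: "0 \<le> C2" "\<forall>\<^sub>F h in at_right 0. 0 < h \<and> (\<forall>\<tau>\<in>{0..1}. norm (g (u h \<tau>) - evv F h \<tau>) \<le> C2 * h ^ k)"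
    using gF by (rule unif_bigo_powerE)
  obtain C3 where C3: "\<forall>\<^sub>F h in at_right 0.
      integral {0..1} (\<lambda>\<tau>. (norm (g (u h \<tau>) - proj r (\<psi> h) (\<lambda>\<sigma>. g (u h \<sigma>)) \<tau>))\<^sup>2) \<le> C3 * (h ^ k)\<^sup>2"
    using residual_mean_square[OF continuous_on_gu F gF k] by blast
  have "\<forall>\<^sub>F h in at_right 0. \<forall>\<tau>\<in>{0..1}. norm (u h \<tau> - evv W' h \<tau>) \<le> (C1 * K + C2 + 1 + C3) * h ^ Suc k"
    using C1(2) C2(2) C3 eventually_stepsize
  proof eventually_elim
    case (elim h)
    interpret orthonormal_01 r "\<psi> h" using elim by (intro system) auto
    define G where "G = (\<lambda>\<sigma>. g (u h \<sigma>))"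
    define e where "e = (\<lambda>\<tau>. G \<tau> - proj r (\<psi> h) G \<tau>)"
    define d where "d = (\<lambda>\<tau>. A *v (u h \<tau> - evv W h \<tau>) + (G \<tau> - evv F h \<tau>) - e \<tau>)"
    \<comment> \<open>A majorant for the derivative of the error. As \<open>e\<close> is controlled
      only through its square, its norm is replaced by
      \<open>h ^ k + (norm e)\<^sup>2 / h ^ k\<close>; with this weight both terms integrate to the
      order of \<open>h ^ k\<close>.\<close>
    define b where "b = (\<lambda>\<tau>. h * ((C1 * K + C2 + 1) * h ^ k + (norm (e \<tau>))\<^sup>2 / h ^ k))"
    have h: "0 < h" "h \<le> h0" using elim by auto
    have Gc: "continuous_on {0..1} G" unfolding G_def by (rule continuous_on_gu[OF h])
    have ec: "continuous_on {0..1} e"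
      unfolding e_def by (intro continuous_intros Gc continuous_on_proj absolutely_integrable_continuous_real)
    have bc: "continuous_on {0..1} b"
      unfolding b_def using h by (intro continuous_intros ec) auto
    have b0: "0 \<le> b \<tau>" for \<tau>
      unfolding b_def using h K C1(1) C2(1) by (intro mult_nonneg_nonneg add_nonneg_nonneg divide_nonneg_nonneg) auto
    have db: "norm (h *\<^sub>R d \<tau>) \<le> b \<tau>" if \<tau>: "\<tau> \<in> {0..1}" for \<tau>
    proof -
      have "norm (d \<tau>) \<le> norm (A *v (u h \<tau> - evv W h \<tau>)) + norm (G \<tau> - evv F h \<tau>) + norm (e \<tau>)"
        unfolding d_def by (rule order_trans[OF norm_triangle_ineq4 add_right_mono[OF norm_triangle_ineq]])
      moreover have "norm (A *v (u h \<tau> - evv W h \<tau>)) \<le> C1 * h ^ k * K"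
        using elim \<tau> K(1) by (intro order_trans[OF K(2)] mult_right_mono) auto
      moreover have "norm (G \<tau> - evv F h \<tau>) \<le> C2 * h ^ k"
        using elim \<tau> by (simp add: G_def)
      moreover have "norm (e \<tau>) \<le> h ^ k + (norm (e \<tau>))\<^sup>2 / h ^ k"
      proof -
        have "0 \<le> norm (e \<tau>) * h ^ k" using h by simp
        with sum_squares_bound[of "norm (e \<tau>)" "h ^ k"]
        have "norm (e \<tau>) * h ^ k \<le> (norm (e \<tau>))\<^sup>2 + (h ^ k)\<^sup>2" by linarith
        then have "norm (e \<tau>) \<le> ((norm (e \<tau>))\<^sup>2 + (h ^ k)\<^sup>2) / h ^ k"
          using h by (subst pos_le_divide_eq) auto
        then show ?thesis using h by (simp add: add_divide_distrib power2_eq_square)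
      qed
      ultimately have "norm (d \<tau>) \<le> C1 * h ^ k * K + C2 * h ^ k + (h ^ k + (norm (e \<tau>))\<^sup>2 / h ^ k)"
        by linarith
      also have "\<dots> = (C1 * K + C2 + 1) * h ^ k + (norm (e \<tau>))\<^sup>2 / h ^ k"
        by (simp add: distrib_right)
      finally have "h * norm (d \<tau>) \<le> b \<tau>"
        unfolding b_def using h by (intro mult_left_mono) auto
      then show ?thesis using h by simp
    qed
    have deriv: "((\<lambda>t. u h t - evv W' h t) has_vector_derivative h *\<^sub>R d \<tau>) (at \<tau> within {0..1})"
      if \<tau>: "\<tau> \<in> {0..1}" for \<tau>
    proof -
      have "h *\<^sub>R d \<tau> = h *\<^sub>R (A *v u h \<tau> + proj r (\<psi> h) G \<tau>) - h *\<^sub>R evv N h \<tau>"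
        unfolding d_def e_def evN by (simp add: matrix_vector_mult_diff_distrib algebra_simps)
      then show ?thesis
        using has_vector_derivative_diff[OF u_deriv[OF h \<tau>] W'_deriv[of h \<tau> "{0..1}"]]
        by (simp add: G_def)
    qed
    show ?case
    proof
      fix \<tau> :: real assume \<tau>: "\<tau> \<in> {0..1}"
      have "((\<lambda>t. h *\<^sub>R d t) has_integral (u h \<tau> - evv W' h \<tau> - (u h 0 - evv W' h 0))) {0..\<tau>}"
        using \<tau> by (intro fundamental_theorem_of_calculus has_vector_derivative_within_subset[OF deriv]) auto
      then have I: "((\<lambda>t. h *\<^sub>R d t) has_integral (u h \<tau> - evv W' h \<tau>)) {0..\<tau>}"
        by (simp add: u_0[OF h] W'_0)
      have bi: "b integrable_on {0..\<tau>}" "b integrable_on {0..1}"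
        using \<tau> by (auto intro!: integrable_continuous_real continuous_on_subset[OF bc])
      have "norm (u h \<tau> - evv W' h \<tau>) = norm (integral {0..\<tau>} (\<lambda>t. h *\<^sub>R d t))"
        unfolding integral_unique[OF I] ..
      also have "\<dots> \<le> integral {0..\<tau>} b"
        using I \<tau> by (intro integral_norm_bound_integral bi db) auto
      \<comment> \<open>Nonnegativity of \<open>b\<close> allows the full interval, which gives a
        bound independent of \<tau>.\<close>
      also have "\<dots> \<le> integral {0..1} b"
        using \<tau> b0 by (intro integral_subset_le bi) auto
      also have "\<dots> = h * ((C1 * K + C2 + 1) * h ^ k + integral {0..1} (\<lambda>\<tau>. (norm (e \<tau>))\<^sup>2) / h ^ k)"
      proof -
        have "(\<lambda>\<tau>. (norm (e \<tau>))\<^sup>2) integrable_on {0..1}"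
          by (intro integrable_continuous_real continuous_intros ec)
        then have "((\<lambda>\<tau>. (norm (e \<tau>))\<^sup>2 / h ^ k) has_integral integral {0..1} (\<lambda>\<tau>. (norm (e \<tau>))\<^sup>2) / h ^ k) {0..1}"
          by (intro has_integral_divide integrable_integral)
        from has_integral_mult_right[OF has_integral_add[OF has_integral_const_real[of "(C1 * K + C2 + 1) * h ^ k" 0 1] this], of h]
        show ?thesis unfolding b_def by (intro integral_unique) simp
      qed
      also have "\<dots> \<le> h * ((C1 * K + C2 + 1) * h ^ k + C3 * (h ^ k)\<^sup>2 / h ^ k)"
        using elim h unfolding e_def G_def by (intro mult_left_mono add_left_mono divide_right_mono) auto
      also have "\<dots> = (C1 * K + C2 + 1 + C3) * h ^ Suc k"
        using h by (simp add: power2_eq_square algebra_simps)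
      finally show "norm (u h \<tau> - evv W' h \<tau>) \<le> (C1 * K + C2 + 1 + C3) * h ^ Suc k" .
    qed
  qed
  then have "unif_bigo_power (Suc k) (\<lambda>h \<tau>. u h \<tau> - evv W' h \<tau>)"
    unfolding unif_bigo_power_def by blast
  with gradedW' show ?thesis by blast
qed

lemma u_expansion:
  assumes "k \<le> r"
  shows "\<exists>W. (\<forall>j. graded 0 (W j)) \<and> unif_bigo_power k (\<lambda>h \<tau>. u h \<tau> - evv W h \<tau>)"
  using assms
proof (induction k)
  case 0
  \<comment> \<open>Boundedness of \<open>u\<close> is an expansion of order zero around the zero
    polynomial.\<close>
  have "unif_bigo_power 0 (\<lambda>h \<tau>. u h \<tau> - evv (\<lambda>_. 0) h \<tau>)"
    using h0 u_bounded by (intro unif_bigo_powerI[of h0 _ B]) (auto simp: evv_def zero_vec_def[symmetric])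
  then show ?case by (intro exI[of _ "\<lambda>_. 0"]) (simp add: graded_0)
next
  case (Suc k)
  then show ?case using u_expansion_step[of _ k] by force
qed

end

section \<open>Preservation of the energy\<close>

text \<open>The exponent is made of one \<open>h\<close> from the time scale and one
  \<open>h ^ r\<close> from the residual of each of \<open>g u\<close> and
  \<open>A *v u\<close>.\<close>

lemma (in ECr_family) energy_defect:
  fixes Q M :: "real^'d^'d" and V :: "real^'d \<Rightarrow> real"
  assumes Q: "invertible Q" "transpose Q = - Q" and M: "transpose M = M"
    and V: "\<And>y. V differentiable (at y)"
    and A: "A = Q ** M" and g: "g = (\<lambda>y. Q *v grad V y)"
  shows "\<exists>C. \<forall>\<^sub>F h in at_right 0. \<bar>energy M V (u h 1) - energy M V y0\<bar> \<le> C * h ^ (2 * r + 1)"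
proof -
  obtain W where W: "\<And>j. graded 0 (W j)" and uW: "unif_bigo_power r (\<lambda>h \<tau>. u h \<tau> - evv W h \<tau>)"
    using u_expansion[of r] by blast
  obtain F where F: "\<And>j. graded 0 (F j)" and gF: "unif_bigo_power r (\<lambda>h \<tau>. g (u h \<tau>) - evv F h \<tau>)"
    using gu_expansion[OF W uW] by blast
  obtain K where K: "K > 0" "\<And>x. norm (A *v x) \<le> norm x * K"
    using bounded_linear.pos_bounded[OF matrix_vector_mul_bounded_linear] by blast
  obtain L where L: "L > 0" "\<And>x. norm (matrix_inv Q *v x) \<le> norm x * L"
    using bounded_linear.pos_bounded[OF matrix_vector_mul_bounded_linear] by blast
  have AW: "unif_bigo_power r (\<lambda>h \<tau>. A *v u h \<tau> - evv (matmul A W) h \<tau>)"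
    using K by (intro unif_bigo_power_bound[OF uW, of _ K] always_eventually)
      (auto simp: evv_matmul mult.commute simp flip: matrix_vector_mult_diff_distrib)
  have Auc: "continuous_on {0..1} (\<lambda>\<tau>. A *v u h \<tau>)" if "0 < h" "h \<le> h0" for h
    by (rule bounded_linear.continuous_on[OF matrix_vector_mul_bounded_linear continuous_on_u[OF that]])
  obtain C where C: "\<forall>\<^sub>F h in at_right 0.
      integral {0..1} (\<lambda>\<tau>. (norm (g (u h \<tau>) - proj r (\<psi> h) (\<lambda>\<sigma>. g (u h \<sigma>)) \<tau>))\<^sup>2) \<le> C * (h ^ r)\<^sup>2"
    using residual_mean_square[OF continuous_on_gu F gF order_refl] by blast
  obtain D where D: "\<forall>\<^sub>F h in at_right 0.
      integral {0..1} (\<lambda>\<tau>. (norm (A *v u h \<tau> - proj r (\<psi> h) (\<lambda>\<sigma>. A *v u h \<sigma>) \<tau>))\<^sup>2) \<le> D * (h ^ r)\<^sup>2"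
    using residual_mean_square[OF Auc graded_matmul[OF W] AW order_refl] by blast
  have "\<forall>\<^sub>F h in at_right 0. \<bar>energy M V (u h 1) - energy M V y0\<bar> \<le> (L * (C + D)) * h ^ (2 * r + 1)"
    using C D eventually_stepsize
  proof eventually_elim
    case (elim h)
    interpret orthonormal_01 r "\<psi> h" using elim by (intro system) auto
    have h: "0 < h" "h \<le> h0" using elim by auto
    define G where "G = (\<lambda>\<sigma>. g (u h \<sigma>))"
    define e where "e = (\<lambda>\<tau>. G \<tau> - proj r (\<psi> h) G \<tau>)"
    define f where "f = (\<lambda>\<tau>. A *v u h \<tau> - proj r (\<psi> h) (\<lambda>\<sigma>. A *v u h \<sigma>) \<tau>)"
    have Gc: "continuous_on {0..1} G" unfolding G_def by (rule continuous_on_gu[OF h])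
    note Gi = absolutely_integrable_continuous_real[OF Gc]
      and Ai = absolutely_integrable_continuous_real[OF Auc[OF h]]
    have ec: "continuous_on {0..1} e" "continuous_on {0..1} f"
      unfolding e_def f_def by (intro continuous_intros Gc Auc[OF h] continuous_on_proj Gi Ai)+
    have e2: "(\<lambda>\<tau>. (norm (e \<tau>))\<^sup>2) integrable_on {0..1}" "(\<lambda>\<tau>. (norm (f \<tau>))\<^sup>2) integrable_on {0..1}"
      by (intro integrable_continuous_real continuous_intros ec)+
    let ?\<Delta> = "energy M V (u h 1) - energy M V y0"
    have I: "((\<lambda>\<tau>. h * ((matrix_inv Q *v e \<tau>) \<bullet> (A *v u h \<tau> + proj r (\<psi> h) G \<tau>))) has_integral ?\<Delta>) {0..1}"
      using energy_balance[OF Q M V, of "u h" h "proj r (\<psi> h) G"] u_deriv[OF h] u_0[OF h]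
      unfolding e_def G_def by (simp add: A g)
    \<comment> \<open>Both projections are combinations of the basis functions, so this integral
      vanishes; subtracting it leaves \<open>f\<close> as the second factor.\<close>
    have "((\<lambda>\<tau>. (matrix_inv Q *v e \<tau>) \<bullet> (proj r (\<psi> h) (\<lambda>\<sigma>. A *v u h \<sigma>) \<tau> + proj r (\<psi> h) G \<tau>))
        has_integral 0) {0..1}"
      using has_integral_residual_combination[OF Gi, of "matrix_inv Q"
          "\<lambda>j. coef j (\<lambda>\<sigma>. A *v u h \<sigma>) + coef j G"]
      by (simp add: e_def proj_eq[OF Ai] proj_eq[OF Gi] scaleR_add_right sum.distrib)
    from has_integral_diff[OF I has_integral_mult_right[OF this, of h]]
    have I: "((\<lambda>\<tau>. h * ((matrix_inv Q *v e \<tau>) \<bullet> f \<tau>)) has_integral ?\<Delta>) {0..1}"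
      by (simp add: f_def inner_diff_right inner_add_right right_diff_distrib distrib_left)
    have "norm (integral {0..1} (\<lambda>\<tau>. h * ((matrix_inv Q *v e \<tau>) \<bullet> f \<tau>)))
        \<le> integral {0..1} (\<lambda>\<tau>. h * L * ((norm (e \<tau>))\<^sup>2 + (norm (f \<tau>))\<^sup>2))"
    proof (rule integral_norm_bound_integral)
      show "(\<lambda>\<tau>. h * ((matrix_inv Q *v e \<tau>) \<bullet> f \<tau>)) integrable_on {0..1}"
        using I by blast
      show "(\<lambda>\<tau>. h * L * ((norm (e \<tau>))\<^sup>2 + (norm (f \<tau>))\<^sup>2)) integrable_on {0..1}"
        by (intro integrable_continuous_real continuous_intros ec)
      fix \<tau> :: real
      \<comment> \<open>The product of norms is bounded pointwise by the sum of their squares, for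
        which the mean-square bounds are available.\<close>
      have "\<bar>(matrix_inv Q *v e \<tau>) \<bullet> f \<tau>\<bar> \<le> norm (matrix_inv Q *v e \<tau>) * norm (f \<tau>)"
        by (rule Cauchy_Schwarz_ineq2)
      also have "\<dots> \<le> norm (e \<tau>) * L * norm (f \<tau>)"
        by (intro mult_right_mono L) auto
      also have "\<dots> = L * (norm (e \<tau>) * norm (f \<tau>))" by simp
      also have "\<dots> \<le> L * ((norm (e \<tau>))\<^sup>2 + (norm (f \<tau>))\<^sup>2)"
      proof (rule mult_left_mono)
        have "0 \<le> norm (e \<tau>) * norm (f \<tau>)" by simp
        with sum_squares_bound[of "norm (e \<tau>)" "norm (f \<tau>)"]
        show "norm (e \<tau>) * norm (f \<tau>) \<le> (norm (e \<tau>))\<^sup>2 + (norm (f \<tau>))\<^sup>2" by linarith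
      qed (use L in simp)
      finally have "h * \<bar>(matrix_inv Q *v e \<tau>) \<bullet> f \<tau>\<bar> \<le> h * (L * ((norm (e \<tau>))\<^sup>2 + (norm (f \<tau>))\<^sup>2))"
        using h by (intro mult_left_mono) auto
      then show "norm (h * ((matrix_inv Q *v e \<tau>) \<bullet> f \<tau>)) \<le> h * L * ((norm (e \<tau>))\<^sup>2 + (norm (f \<tau>))\<^sup>2)"
        using h by (simp add: abs_mult mult.assoc)
    qed
    also have "\<dots> = h * L * (integral {0..1} (\<lambda>\<tau>. (norm (e \<tau>))\<^sup>2) + integral {0..1} (\<lambda>\<tau>. (norm (f \<tau>))\<^sup>2))"
      by (simp add: integral_add e2)
    also have "\<dots> \<le> h * L * (C * (h ^ r)\<^sup>2 + D * (h ^ r)\<^sup>2)"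
      using elim h L unfolding e_def f_def G_def by (intro mult_left_mono add_mono) auto
    also have "\<dots> = (L * (C + D)) * (h * (h ^ r)\<^sup>2)"
      by (simp add: algebra_simps)
    also have "h * (h ^ r)\<^sup>2 = h ^ (2 * r + 1)"
      by (simp add: mult.commute flip: power_mult)
    finally show ?case unfolding integral_unique[OF I] real_norm_def .
  qed
  then show ?thesis by blast
qed

section \<open>Change of basis and smoothness of the vector field\<close>

lemma scalar_span_self: "i < r \<Longrightarrow> f i \<in> scalar_span r f"
  unfolding scalar_span_def
  by (auto intro!: exI[of _ "\<lambda>j. if j = i then 1 else 0"] simp: if_distrib[of "\<lambda>c. c * _"] cong: if_cong)

text \<open>Vector coefficients are allowed, so that elements of the space \<open>Y\<close> can be
  rewritten in the orthonormal basis; the proof exchanges two finite sums.\<close>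

lemma scalar_span_combination:
  fixes W :: "nat \<Rightarrow> 'a::real_vector"
  assumes "\<And>i. i < r \<Longrightarrow> f i \<in> scalar_span r \<psi>"
  shows "\<exists>W'. \<forall>\<tau>\<in>{0..1}. (\<Sum>i<r. f i \<tau> *\<^sub>R W i) = (\<Sum>j<r. \<psi> j \<tau> *\<^sub>R W' j)"
proof -
  have "\<forall>i. \<exists>c. i < r \<longrightarrow> (\<forall>\<tau>\<in>{0..1}. f i \<tau> = (\<Sum>j<r. c j * \<psi> j \<tau>))"
    using assms by (auto simp: scalar_span_def)
  then obtain c where c: "\<forall>i. i < r \<longrightarrow> (\<forall>\<tau>\<in>{0..1}. f i \<tau> = (\<Sum>j<r. c i j * \<psi> j \<tau>))"
    by (rule choice[THEN exE])
  have "(\<Sum>i<r. f i \<tau> *\<^sub>R W i) = (\<Sum>j<r. \<psi> j \<tau> *\<^sub>R (\<Sum>i<r. c i j *\<^sub>R W i))" if "\<tau> \<in> {0..1}" for \<tau>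
  proof -
    have "(\<Sum>i<r. f i \<tau> *\<^sub>R W i) = (\<Sum>i<r. \<Sum>j<r. \<psi> j \<tau> *\<^sub>R (c i j *\<^sub>R W i))"
      using c that by (intro sum.cong refl) (simp add: scaleR_sum_left mult.commute)
    also have "\<dots> = (\<Sum>j<r. \<psi> j \<tau> *\<^sub>R (\<Sum>i<r. c i j *\<^sub>R W i))"
      by (subst sum.swap) (simp add: scaleR_sum_right)
    finally show ?thesis .
  qed
  then show ?thesis by (intro exI[of _ "\<lambda>j. \<Sum>i<r. c i j *\<^sub>R W i"]) blast
qed

text \<open>Continuity passes to each basis function through the common span, as a combination of
  continuous functions.\<close>

lemma orthonormal_01_basis:
  assumes "orthonormal_basis_01 r f \<psi>" and f: "\<And>i. i < r \<Longrightarrow> continuous_on {0..1} (f i)"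
  shows "orthonormal_01 r \<psi>"
proof
  fix i assume "i < r"
  then have "\<psi> i \<in> scalar_span r f"
    using scalar_span_self[of i r \<psi>] assms(1) by (simp add: orthonormal_basis_01_def)
  then obtain c where c: "\<And>\<tau>. \<tau> \<in> {0..1} \<Longrightarrow> \<psi> i \<tau> = (\<Sum>j<r. c j * f j \<tau>)"
    by (auto simp: scalar_span_def)
  have "continuous_on {0..1} (\<lambda>\<tau>. \<Sum>j<r. c j * f j \<tau>)"
    by (intro continuous_intros f) simp
  then show "continuous_on {0..1} (\<psi> i)"
    by (rule continuous_on_eq) (simp add: c)
qed (use assms(1) in \<open>simp add: orthonormal_basis_01_def\<close>)

text \<open>The component is the directional derivative of \<open>V\<close> along the i-th row of
  \<open>Q\<close>, so exactly one order of smoothness is spent.\<close>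

lemma Ck_on_grad_component:
  fixes V :: "real^'d \<Rightarrow> real" and Q :: "real^'d^'d"
  assumes "Ck_on (Suc k) UNIV V"
  shows "Ck_on k UNIV (\<lambda>x. (Q *v grad V x) $ i)"
proof -
  obtain V' where V': "\<And>x. (V has_derivative V' x) (at x)" and C: "\<And>v. Ck_on k UNIV (\<lambda>x. V' x v)"
    using assms by auto
  have "V' x v = v \<bullet> grad V x" for x v
  proof -
    have "GDERIV V x :> grad V x"
      using V' by (intro GDERIV_grad) (auto simp: differentiable_def)
    then have "V' x = (\<lambda>v. v \<bullet> grad V x)"
      unfolding gderiv_def using V' has_derivative_unique by blast
    then show ?thesis by simp
  qed
  then have "(\<lambda>x. (Q *v grad V x) $ i) = (\<lambda>x. V' x (Q $ i))"
    by (simp add: matrix_vector_mul_component)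
  then show ?thesis using C by simp
qed

theorem theorem1:
  fixes Q M :: "real^'d^'d"
    and V :: "real^'d \<Rightarrow> real"
    and y0 :: "real^'d"
    and r :: nat
    and \<phi> :: "nat \<Rightarrow> real \<Rightarrow> real"
    and \<psi> :: "real \<Rightarrow> nat \<Rightarrow> real \<Rightarrow> real"
    and X :: "real \<Rightarrow> (real \<Rightarrow> real^'d) set"
    and S :: "real set"
    and u :: "real \<Rightarrow> real \<Rightarrow> real^'d"
  defines "H \<equiv> energy M V"
    and "A \<equiv> Q ** M"
    and "g \<equiv> (\<lambda>y. Q *v grad V y)"
  assumes Q_inv: "invertible Q"
    and Q_skew: "transpose Q = - Q"
    and M_sym: "transpose M = M"
    and V_diff: "\<And>y. V differentiable (at y)"
    and r_pos: "r \<ge> 1"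
    and phi_smooth: "\<And>i. i < r \<Longrightarrow> Ck_on r {0..} (\<phi> i)"
    and stepsizes_pos: "S \<subseteq> {0<..}"
    and phi_indep: "\<And>h. h \<in> S \<Longrightarrow> lin_indep_01 r (\<lambda>i. stretch h (\<phi> i))"
    and psi_basis: "\<And>h. h \<in> S \<Longrightarrow> orthonormal_basis_01 r (\<lambda>i. stretch h (\<phi> i)) (\<psi> h)"
    and X_adm: "\<And>h. h \<in> S \<Longrightarrow> X_admissible r \<phi> h (X h)"
    and u_sol: "\<And>h. h \<in> S \<Longrightarrow> ECr_solution h (kernel r (\<psi> h)) A g y0 (u h)"
  shows "first_integral (\<lambda>y. Q *v grad H y) H
    \<and> (\<forall>h\<in>S. u h \<in> X h \<longrightarrow> H (u h 1) = H y0)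
    \<and> (\<forall>h0>0. \<forall>R>0.
         {0<..h0} \<subseteq> S
         \<and> Ck_on (r + 1) UNIV V
         \<and> (\<forall>h\<in>{0<..h0}. \<forall>\<tau>\<in>{0..1}. u h \<tau> \<in> cball (matrix_exp ((\<tau> * h) *\<^sub>R A) *v y0) R)
         \<and> kernel_extends_smoothly r \<psi> h0
         \<and> (\<forall>w :: real \<Rightarrow> real \<Rightarrow> real^'d. regular r w \<longrightarrow>
              unif_bigo_power r (\<lambda>h \<tau>. proj r (\<psi> h) (w h) \<tau> - w h \<tau>))
         \<longrightarrow> (\<lambda>h. H (u h 1) - H y0)
               \<in> O[at 0 within {h\<in>S. u h \<notin> X h}](\<lambda>h. h ^ (2 * r + 1)))"
proof -
  have \<psi>: "orthonormal_01 r (\<psi> h)" if "h \<in> S" for h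
  proof (rule orthonormal_01_basis[OF psi_basis[OF that]])
    fix i assume "i < r"
    have "0 < h" using that stepsizes_pos by auto
    then show "continuous_on {0..1} (stretch h (\<phi> i))"
      unfolding stretch_def[abs_def]
      by (intro continuous_on_compose2[OF Ck_on_imp_continuous_on[OF phi_smooth[OF \<open>i < r\<close>]]]
          continuous_intros) auto
  qed
  have deriv: "(u h has_vector_derivative
      h *\<^sub>R (A *v u h \<tau> + proj r (\<psi> h) (\<lambda>\<sigma>. g (u h \<sigma>)) \<tau>)) (at \<tau> within {0..1})"
    if "h \<in> S" "\<tau> \<in> {0..1}" for h \<tau>
    using orthonormal_01.ECr_solution_deriv[OF \<psi> u_sol] that by blast
  have u0: "u h 0 = y0" if "h \<in> S" for h
    using orthonormal_01.ECr_solution_0[OF \<psi> u_sol] that by blast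
  have exact: "H (u h 1) = H y0" if h: "h \<in> S" and uX: "u h \<in> X h" for h
  proof -
    interpret orthonormal_01 r "\<psi> h" by (rule \<psi>[OF h])
    define p where "p = proj r (\<psi> h) (\<lambda>\<sigma>. g (u h \<sigma>))"
    have Gi: "(\<lambda>\<sigma>. g (u h \<sigma>)) absolutely_integrable_on {0..1}"
      using u_sol[OF h] by (simp add: ECr_solution_def)
    obtain w where w: "w \<in> Y_space r \<phi> h"
      and wd: "\<forall>\<tau>\<in>{0..1}. (u h has_vector_derivative h *\<^sub>R w \<tau>) (at \<tau> within {0..1})"
      using X_adm[OF h] uX unfolding X_admissible_def by blast
    obtain W where W: "\<forall>\<tau>\<in>{0..1}. w \<tau> = (\<Sum>i<r. stretch h (\<phi> i) \<tau> *\<^sub>R W i)"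
      using w unfolding Y_space_def by blast
    have "stretch h (\<phi> i) \<in> scalar_span r (\<psi> h)" if "i < r" for i
      using scalar_span_self[OF that, of "\<lambda>i. stretch h (\<phi> i)"] psi_basis[OF h]
      by (simp add: orthonormal_basis_01_def)
    then obtain W' where W': "\<forall>\<tau>\<in>{0..1}. (\<Sum>i<r. stretch h (\<phi> i) \<tau> *\<^sub>R W i) = (\<Sum>j<r. \<psi> h j \<tau> *\<^sub>R W' j)"
      using scalar_span_combination[of r "\<lambda>i. stretch h (\<phi> i)" "\<psi> h" W] by blast
    \<comment> \<open>The derivative of \<open>u\<close> is known twice, from membership in
      \<open>X\<close> and from the method; cancelling \<open>h\<close> identifies
      \<open>A *v u + p\<close> with an element of \<open>Y\<close>, to which the residual is
      orthogonal.\<close>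
    have eq: "(\<Sum>j<r. \<psi> h j \<tau> *\<^sub>R W' j) = A *v u h \<tau> + p \<tau>" if \<tau>: "\<tau> \<in> {0..1}" for \<tau>
    proof -
      have "h *\<^sub>R w \<tau> = h *\<^sub>R (A *v u h \<tau> + p \<tau>)"
        unfolding p_def
        by (rule vector_derivative_unique_within_closed_interval[of 0 1 \<tau> "u h"])
          (use wd deriv[OF h \<tau>] \<tau> in auto)
      moreover have "h \<noteq> 0" using h stepsizes_pos by auto
      ultimately show ?thesis using W W' \<tau> by simp
    qed
    have "((\<lambda>\<tau>. (matrix_inv Q *v (g (u h \<tau>) - p \<tau>)) \<bullet> (A *v u h \<tau> + p \<tau>)) has_integral 0) {0..1}"
      using has_integral_residual_combination[OF Gi, of "matrix_inv Q" W', folded p_def]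
      by (rule has_integral_eq[rotated]) (simp only: eq)
    from has_integral_mult_right[OF this, of h]
    have "((\<lambda>\<tau>. h * ((matrix_inv Q *v (g (u h \<tau>) - p \<tau>)) \<bullet> (A *v u h \<tau> + p \<tau>))) has_integral 0) {0..1}"
      by simp
    moreover have "((\<lambda>\<tau>. h * ((matrix_inv Q *v (g (u h \<tau>) - p \<tau>)) \<bullet> (A *v u h \<tau> + p \<tau>)))
        has_integral (H (u h 1) - H (u h 0))) {0..1}"
      using energy_balance[OF Q_inv Q_skew M_sym V_diff, of "u h" h p] deriv[OF h]
      unfolding H_def A_def g_def p_def by blast
    ultimately have "H (u h 1) - H (u h 0) = 0"
      using has_integral_unique by blast
    then show ?thesis by (simp add: u0[OF h])
  qed
  have approx: "(\<lambda>h. H (u h 1) - H y0) \<in> O[at 0 within {h\<in>S. u h \<notin> X h}](\<lambda>h. h ^ (2 * r + 1))"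
    if h0: "0 < h0" and S: "{0<..h0} \<subseteq> S" and V: "Ck_on (r + 1) UNIV V"
      and ball: "\<forall>h\<in>{0<..h0}. \<forall>\<tau>\<in>{0..1}. u h \<tau> \<in> cball (matrix_exp ((\<tau> * h) *\<^sub>R A) *v y0) R"
      and reg: "\<forall>w :: real \<Rightarrow> real \<Rightarrow> real^'d. regular r w \<longrightarrow>
        unif_bigo_power r (\<lambda>h \<tau>. proj r (\<psi> h) (w h) \<tau> - w h \<tau>)" for h0 R
  proof -
    have inS: "h \<in> S" if "0 < h" "h \<le> h0" for h
      using that S by auto
    let ?E = "\<lambda>t. matrix_exp (t *\<^sub>R A) *v y0"
    have "continuous_on {0..h0} ?E"
      by (intro bounded_bilinear.continuous_on[OF bounded_bilinear_matrix_vector_mult] continuous_intros)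
        (auto simp: continuous_on_eq_continuous_within
          intro: has_vector_derivative_continuous[OF matrix_exp_deriv])
    then have "bounded (?E ` {0..h0})"
      by (intro compact_imp_bounded compact_continuous_image) auto
    \<comment> \<open>The free evolution is bounded for times in \<open>{0..h0}\<close>, so
      solutions within distance \<open>R\<close> of it share the bound \<open>B + R\<close> for all
      stepsizes.\<close>
    then obtain B where B: "\<forall>x\<in>?E ` {0..h0}. norm x \<le> B"
      using bounded_iff by blast
    interpret ECr_family r \<psi> A g y0 u h0 "B + R"
    proof (rule ECr_family.intro)
      fix h \<tau> :: real assume h: "0 < h" "h \<le> h0" and \<tau>: "\<tau> \<in> {0..1}"
      have "\<tau> * h \<le> h" using h \<tau> by (intro mult_left_le_one_le) auto
      then have "\<tau> * h \<le> h0" using h(2) by (rule order_trans)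
      then have "\<tau> * h \<in> {0..h0}" using h \<tau> by simp
      then have "norm (?E (\<tau> * h)) \<le> B" using B by blast
      moreover have "dist (?E (\<tau> * h)) (u h \<tau>) \<le> R" using ball h \<tau> by simp
      moreover have "norm (u h \<tau>) \<le> norm (?E (\<tau> * h)) + dist (?E (\<tau> * h)) (u h \<tau>)"
        by (simp add: dist_norm norm_triangle_sub norm_minus_commute)
      ultimately show "norm (u h \<tau>) \<le> B + R" by linarith
    next
      show "Ck_on r UNIV (\<lambda>x. g x $ i)" for i
        unfolding g_def using V by (intro Ck_on_grad_component) simp
    qed (use h0 r_pos \<psi> deriv u0 inS reg in auto)
    obtain C where C: "\<forall>\<^sub>F h in at_right 0. \<bar>energy M V (u h 1) - energy M V y0\<bar> \<le> C * h ^ (2 * r + 1)"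
      using energy_defect[OF Q_inv Q_skew M_sym V_diff] A_def g_def by metis
    \<comment> \<open>The estimate holds for all small positive stepsizes and is restricted
      afterwards to those for which \<open>u\<close> lies outside \<open>X\<close>, whatever that
      set looks like near 0.\<close>
    have "{h\<in>S. u h \<notin> X h} \<subseteq> {0<..}" using stepsizes_pos by auto
    then have le: "at 0 within {h\<in>S. u h \<notin> X h} \<le> at_right 0" by (rule at_le)
    show ?thesis
    proof (rule bigoI)
      have "\<forall>\<^sub>F h in at_right 0. norm (H (u h 1) - H y0) \<le> C * norm (h ^ (2 * r + 1))"
        using C eventually_at_right_less[of 0] by eventually_elim (simp add: H_def)
      then show "\<forall>\<^sub>F h in at 0 within {h\<in>S. u h \<notin> X h}. norm (H (u h 1) - H y0) \<le> C * norm (h ^ (2 * r + 1))"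
        by (rule filter_leD[OF le])
    qed
  qed
  show ?thesis
    using first_integral_energy[OF Q_skew M_sym V_diff] exact approx unfolding H_def by blast
qed

end
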